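(* Let $G$ be a graph with the smallest number of vertices among all graphs satisfying both of the following conditions: \begin{itemize} \item there exists a $\mathbb{Z}_3$-boundary $\beta$ for $G$ such that $(G,\beta)$ is flow-critical, and \item $|E(G)|>3|V(G)|-5$. \end{itemize} Then $G$ is triangle-free, $5$-edge-connected, and the only $5$-edge-cuts in $G$ are the vertex neighborhoods (that is, every edge-cut of size $5$ consists of all the edges incident with some single vertex).
   Context: Graphs are finite and may have parallel edges, but no loops. A $\mathbb{Z}_3$-boundary for a graph $G$ is a function $\beta:V(G)\to\mathbb{Z}_3$ such that $\sum_{v\in V(C)}\beta(v)=0$ for every component $C$ of $G$; the pair $(G,\beta)$ is then called a $\mathbb{Z}_3$-bordered graph. The symmetric orientation of $G$ is the directed graph obtained by replacing every edge $e=uv$ by two oppositely directed edges $e_u$ (directed towards $u$) and $e_v$ (directed towards $v$). A flow in $(G,\beta)$ is a function $f$ from the edges of the symmetric orientation to $\mathbb{Z}_3$ such that $f(e_u)=-f(e_v)$ for every $e=uv\in E(G)$, and $\sum_{e=uv\in E(G)} f(e_v)=\beta(u)$ for every $u\in V(G)$. It is nowhere-zero if it does not use the value $0$. For a partition $\mathcal{P}$ of $V(G)$, $G/\mathcal{P}$ is the graph obtained by identifying the vertices in each part of $\mathcal{P}$ to a single vertex and removing all resulting loops (parallel edges are kept); $\beta/\mathcal{P}$ assigns to the vertex arising from a part $P$ the value $\sum_{v\in P}\beta(v)$; and $(G,\beta)/\mathcal{P}=(G/\mathcal{P},\beta/\mathcal{P})$. The partition is $G$-connected if each part induces a connected subgraph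 of $G$; in this case $(G,\beta)/\mathcal{P}$ is a contraction of $(G,\beta)$, and it is a proper contraction if some part has more than one vertex. A $\mathbb{Z}_3$-bordered graph $(G,\beta)$ is flow-critical if $G$ is connected, $(G,\beta)$ has no nowhere-zero flow, but every proper contraction of $(G,\beta)$ has a nowhere-zero flow. *)

theory Defs
  imports "HOL-Library.Numeral_Type" "HOL-Library.Disjoint_Sets"
begin

text \<open>Throughout, \<open>\<int>\<^sub>3\<close> is the ring type \<open>3\<close> of \<open>Numeral_Type\<close>, with arithmetic modulo 3.\<close>

record ('v, 'e) mgraph =
  verts :: "'v set"
  edges :: "'e set"
  ends :: "'e \<Rightarrow> 'v set"

definition multigraph :: "('v, 'e) mgraph \<Rightarrow> bool" where
  "multigraph G \<longleftrightarrow> finite (verts G) \<and> finite (edges G) \<and>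
     (\<forall>e\<in>edges G. \<exists>u\<in>verts G. \<exists>v\<in>verts G. u \<noteq> v \<and> ends G e = {u, v})"

definition adjacent :: "('v, 'e) mgraph \<Rightarrow> 'v \<Rightarrow> 'v \<Rightarrow> bool" where
  "adjacent G u v \<longleftrightarrow> (\<exists>e\<in>edges G. ends G e = {u, v})"

definition connected_graph :: "('v, 'e) mgraph \<Rightarrow> bool" where
  "connected_graph G \<longleftrightarrow> verts G \<noteq> {} \<and>
     (\<forall>u\<in>verts G. \<forall>v\<in>verts G. (adjacent G)\<^sup>*\<^sup>* u v)"

text \<open>Components are represented by their vertex sets.\<close>

definition components :: "('v, 'e) mgraph \<Rightarrow> 'v set set" where
  "components G = {{w\<in>verts G. (adjacent G)\<^sup>*\<^sup>* v w} | v. v \<in> verts G}"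

definition induced_subgraph :: "('v, 'e) mgraph \<Rightarrow> 'v set \<Rightarrow> ('v, 'e) mgraph" where
  "induced_subgraph G A = \<lparr>verts = A, edges = {e\<in>edges G. ends G e \<subseteq> A}, ends = ends G\<rparr>"

definition delete_edges :: "('v, 'e) mgraph \<Rightarrow> 'e set \<Rightarrow> ('v, 'e) mgraph" where
  "delete_edges G F = \<lparr>verts = verts G, edges = edges G - F, ends = ends G\<rparr>"

definition Z3_boundary :: "('v, 'e) mgraph \<Rightarrow> ('v \<Rightarrow> 3) \<Rightarrow> bool" where
  "Z3_boundary G \<beta> \<longleftrightarrow> (\<forall>C\<in>components G. (\<Sum>v\<in>C. \<beta> v) = 0)"

text \<open>The edge \<open>e\<^sub>v\<close> of the symmetric orientation (the copy of \<open>e\<close> directed towards its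
  end \<open>v\<close>) is the pair \<open>(e, v)\<close>. Values of functions outside the pairs
  of this form are irrelevant.\<close>

definition symmetric_arcs :: "('v, 'e) mgraph \<Rightarrow> ('e \<times> 'v) set" where
  "symmetric_arcs G = {(e, v). e \<in> edges G \<and> v \<in> ends G e}"

definition Z3_flow :: "('v, 'e) mgraph \<Rightarrow> ('v \<Rightarrow> 3) \<Rightarrow> ('e \<times> 'v \<Rightarrow> 3) \<Rightarrow> bool" where
  "Z3_flow G \<beta> f \<longleftrightarrow>
     (\<forall>e\<in>edges G. \<forall>u v. ends G e = {u, v} \<longrightarrow> f (e, u) = - f (e, v)) \<and>
     (\<forall>u\<in>verts G. (\<Sum>(e, v)\<in>{(e, v). e \<in> edges G \<and> ends G e = {u, v}}. f (e, v)) = \<beta> u)"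

definition has_nowhere_zero_flow :: "('v, 'e) mgraph \<Rightarrow> ('v \<Rightarrow> 3) \<Rightarrow> bool" where
  "has_nowhere_zero_flow G \<beta> \<longleftrightarrow> (\<exists>f. Z3_flow G \<beta> f \<and> (\<forall>a\<in>symmetric_arcs G. f a \<noteq> 0))"

text \<open>The vertices of a quotient are the parts themselves, and the surviving edges keep their
  names; an edge inside a part would become a loop and is removed.\<close>

definition quotient_graph :: "('v, 'e) mgraph \<Rightarrow> 'v set set \<Rightarrow> ('v set, 'e) mgraph" where
  "quotient_graph G \<P> =
     \<lparr>verts = \<P>,
      edges = {e\<in>edges G. \<forall>P\<in>\<P>. \<not> ends G e \<subseteq> P},
      ends = (\<lambda>e. {P\<in>\<P>. ends G e \<inter> P \<noteq> {}})\<rparr>"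

definition quotient_boundary :: "('v \<Rightarrow> 3) \<Rightarrow> 'v set \<Rightarrow> 3" where
  "quotient_boundary \<beta> P = (\<Sum>v\<in>P. \<beta> v)"

definition G_connected_partition :: "('v, 'e) mgraph \<Rightarrow> 'v set set \<Rightarrow> bool" where
  "G_connected_partition G \<P> \<longleftrightarrow> partition_on (verts G) \<P> \<and>
     (\<forall>P\<in>\<P>. connected_graph (induced_subgraph G P))"

definition flow_critical :: "('v, 'e) mgraph \<Rightarrow> ('v \<Rightarrow> 3) \<Rightarrow> bool" where
  "flow_critical G \<beta> \<longleftrightarrow> connected_graph G \<and> \<not> has_nowhere_zero_flow G \<beta> \<and>
     (\<forall>\<P>. G_connected_partition G \<P> \<and> (\<exists>P\<in>\<P>. card P > 1) \<longrightarrow>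
        has_nowhere_zero_flow (quotient_graph G \<P>) (quotient_boundary \<beta>))"

definition dense_flow_critical :: "('v, 'e) mgraph \<Rightarrow> bool" where
  "dense_flow_critical G \<longleftrightarrow> multigraph G \<and>
     (\<exists>\<beta>. Z3_boundary G \<beta> \<and> flow_critical G \<beta>) \<and>
     int (card (edges G)) > 3 * int (card (verts G)) - 5"

definition triangle_free :: "('v, 'e) mgraph \<Rightarrow> bool" where
  "triangle_free G \<longleftrightarrow> \<not> (\<exists>u v w. u \<noteq> v \<and> v \<noteq> w \<and> u \<noteq> w \<and>
     adjacent G u v \<and> adjacent G v w \<and> adjacent G u w)"

definition edge_connected :: "nat \<Rightarrow> ('v, 'e) mgraph \<Rightarrow> bool" where
  "edge_connected k G \<longleftrightarrow> card (verts G) \<ge> 2 \<and>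
     (\<forall>F\<subseteq>edges G. card F < k \<longrightarrow> connected_graph (delete_edges G F))"

definition edge_cut :: "('v, 'e) mgraph \<Rightarrow> 'e set \<Rightarrow> bool" where
  "edge_cut G C \<longleftrightarrow> (\<exists>A. A \<noteq> {} \<and> A \<subset> verts G \<and>
     C = {e\<in>edges G. ends G e \<inter> A \<noteq> {} \<and> ends G e \<inter> (verts G - A) \<noteq> {}})"

definition incident_edges :: "('v, 'e) mgraph \<Rightarrow> 'v \<Rightarrow> 'e set" where
  "incident_edges G v = {e\<in>edges G. v \<in> ends G e}"

end

theory Submission imports Defs
begin

text \<open>Let \<open>n\<close> be the number of vertices of the minimal graph \<open>G\<close>, and write \<open>e(A)\<close> for
  the number of edges of a graph inside a vertex set \<open>A\<close>. Everything rests on one density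
  estimate (\<open>no_flow_density\<close>): if a graph \<open>H\<close> with fewer than \<open>n\<close> vertices has a boundary
  of total \<open>0\<close> without nowhere-zero flow, and \<open>e(A) \<le> 3|A| - 3\<close> for every proper nonempty
  \<open>A\<close>, then \<open>|E(H)| \<le> 3|V(H)| - 5\<close>. Indeed, among all partitions of \<open>V(H)\<close> whose quotient
  still has no flow, take one with the fewest parts. If its quotient \<open>K\<close> is connected,
  then \<open>K\<close> is flow-critical with fewer than \<open>n\<close> vertices, so \<open>|E(K)| \<le> 3|V(K)| - 5\<close> by the
  choice of \<open>G\<close>, and adding the at most \<open>3|P| - 3\<close> edges inside each part \<open>P\<close> gives the
  bound. If \<open>K\<close> is disconnected, then so is \<open>H\<close>, and the bounds for the two sides add up
  to \<open>3|V(H)| - 6\<close>.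

  Contracting a proper connected set \<open>A\<close> of at least two vertices of \<open>G\<close> produces a flow,
  and what this flow leaves to be achieved inside \<open>A\<close> is a boundary for \<open>G[A]\<close> that no
  nowhere-zero flow of \<open>G[A]\<close> attains. By induction on \<open>|A|\<close>, the estimate gives \<open>e(A) \<le>
  3|A| - 5\<close> (\<open>inner_sparse\<close>). Comparing this with \<open>|E(G)| \<ge> 3n - 4\<close> shows that a cut with
  at least two vertices on either side has at least \<open>6\<close> edges, and that every vertex has
  degree at least \<open>4\<close>. For \<open>|A| = 2\<close> the bound is \<open>1\<close>, so \<open>G\<close> has no parallel edges, once
  graphs with at most two vertices are ruled out directly.

  Degree \<open>4\<close> and triangles are excluded by splitting off: replacing two edges \<open>zx\<close> and
  \<open>zy\<close> by one edge \<open>xy\<close> cannot create a flow, since a flow can be rerouted back through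
  \<open>z\<close>. At a vertex of degree \<open>4\<close>, split off two of its edges and delete the vertex; its
  two other edges can carry nonzero values of any prescribed sum. This removes one vertex
  and three edges. In a triangle \<open>xyz\<close>, split off \<open>zx\<close> and \<open>zy\<close>, which doubles the edge
  \<open>xy\<close>, and contract the pair; two parallel edges can meet any demand at their ends, so
  again no flow appears, and again one vertex and three edges are lost. In both cases the
  resulting graph is still sparse on all proper vertex subsets but has at least \<open>3(n - 1)
  - 4\<close> edges, against the density estimate.\<close>

section \<open>Values in the cyclic group of order three\<close>

lemma Z3_triple: "(d::3) + d + d = 0"
proof -
  have three: "(1 + 1 + 1 :: 3) = 0" by simp
  have "d + d + d = (1 + 1 + 1) * d" by (simp only: distrib_right mult_1_left)
  then show ?thesis by (simp only: three mult_zero_left)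
qed

text \<open>Two free edges with nonzero values can meet every required sum; a single one
  cannot meet \<open>0\<close>.\<close>

lemma Z3_sum_of_two_nonzero: "\<exists>a b :: 3. a \<noteq> 0 \<and> b \<noteq> 0 \<and> a + b = d"
proof (cases "d = 0")
  case True
  then show ?thesis by (intro exI[of _ 1] exI[of _ "- 1"]) simp
next
  case False
  have "d - (- d + - d) = d + d + d" by (simp only: diff_conv_add_uminus minus_add_distrib minus_minus add.assoc)
  then have "- d + - d = d" by (simp only: Z3_triple right_minus_eq)
  then show ?thesis using False neg_equal_0_iff_equal[of d] by blast
qed

section \<open>Flows as outflows of vertex sets\<close>

text \<open>Here \<open>g e v\<close> is the value of the copy of \<open>e\<close> leaving \<open>v\<close>; for an edge with two
  ends, antisymmetry says that its values add up to zero. In this form the flow condition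
  no longer refers to the other end of an edge, so that it extends from vertices to vertex
  sets.\<close>

definition nowhere_zero_arcs :: "('v, 'e) mgraph \<Rightarrow> ('e \<Rightarrow> 'v \<Rightarrow> 3) \<Rightarrow> bool" where
  "nowhere_zero_arcs G g \<longleftrightarrow>
     (\<forall>e\<in>edges G. (\<Sum>v\<in>ends G e. g e v) = 0 \<and> (\<forall>v\<in>ends G e. g e v \<noteq> 0))"

text \<open>For antisymmetric values, the edges inside \<open>A\<close> cancel in the outflow of \<open>A\<close>. Hence
  a flow in a quotient amounts to arc values in the original graph whose outflow is right
  on every part, whatever happens within the parts.\<close>

definition outflow :: "('v, 'e) mgraph \<Rightarrow> ('e \<Rightarrow> 'v \<Rightarrow> 3) \<Rightarrow> 'v set \<Rightarrow> 3" where
  "outflow G g A = (\<Sum>e\<in>edges G. \<Sum>v\<in>ends G e \<inter> A. g e v)"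

lemma multigraph_edgeE:
  assumes "multigraph G" "e \<in> edges G"
  obtains u v where "u \<noteq> v" "u \<in> verts G" "v \<in> verts G" "ends G e = {u, v}"
  using assms unfolding multigraph_def by blast

lemma multigraph_finite:
  assumes "multigraph G"
  shows "finite (verts G)" "finite (edges G)"
  using assms unfolding multigraph_def by auto

lemma ends_verts: "multigraph G \<Longrightarrow> e \<in> edges G \<Longrightarrow> ends G e \<subseteq> verts G"
  by (elim multigraph_edgeE) auto

lemma outflow_singleton:
  "outflow G g {u} = (\<Sum>e\<in>edges G. if u \<in> ends G e then g e u else 0)"
  unfolding outflow_def by (intro sum.cong) auto

lemma outflow_sum:
  assumes "finite A"
  shows "outflow G g A = (\<Sum>u\<in>A. outflow G g {u})"
proof -
  have "(\<Sum>v\<in>ends G e \<inter> A. g e v) = (\<Sum>u\<in>A. if u \<in> ends G e then g e u else 0)" for e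
    using assms by (simp add: sum.inter_restrict Int_commute)
  then have "outflow G g A = (\<Sum>e\<in>edges G. \<Sum>u\<in>A. if u \<in> ends G e then g e u else 0)"
    unfolding outflow_def by simp
  also have "\<dots> = (\<Sum>u\<in>A. outflow G g {u})"
    unfolding outflow_singleton by (rule sum.swap)
  finally show ?thesis .
qed

lemma outflow_verts:
  assumes "multigraph G" "nowhere_zero_arcs G g"
  shows "outflow G g (verts G) = 0"
proof -
  have "(\<Sum>v\<in>ends G e \<inter> verts G. g e v) = 0" if "e \<in> edges G" for e
    using assms that ends_verts[OF assms(1) that] by (simp add: nowhere_zero_arcs_def Int_absorb2)
  then show ?thesis unfolding outflow_def by simp
qed

text \<open>The flow condition at \<open>u\<close> sums over the arcs leaving \<open>u\<close>, each indexed by its edge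
  and its head. By antisymmetry the head can be replaced by \<open>u\<close> itself, up to sign.\<close>

lemma arc_sum_eq_outflow:
  assumes G: "multigraph G"
    and anti: "\<And>e u v. e \<in> edges G \<Longrightarrow> ends G e = {u, v} \<Longrightarrow> f (e, u) = - f (e, v)"
  shows "(\<Sum>(e, v)\<in>{(e, v). e \<in> edges G \<and> ends G e = {u, v}}. f (e, v))
    = outflow G (\<lambda>e v. - f (e, v)) {u}"
proof -
  define other where "other e = (THE v. ends G e = {u, v})" for e
  have other: "other e = v" if "ends G e = {u, v}" for e v
    unfolding other_def by (rule the_equality) (use that in \<open>auto simp: doubleton_eq_iff\<close>)
  have ex: "\<exists>v. ends G e = {u, v}" if "e \<in> edges G" "u \<in> ends G e" for e
    by (rule multigraph_edgeE[OF G that(1)]) (use that(2) in auto)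
  have set: "{(e, v). e \<in> edges G \<and> ends G e = {u, v}}
      = (\<lambda>e. (e, other e)) ` {e \<in> edges G. u \<in> ends G e}"
  proof (intro equalityI subsetI)
    fix p assume "p \<in> {(e, v). e \<in> edges G \<and> ends G e = {u, v}}"
    then obtain e v where p: "p = (e, v)" "e \<in> edges G" "ends G e = {u, v}" by blast
    then have "p = (e, other e)" "u \<in> ends G e" using other by auto
    then show "p \<in> (\<lambda>e. (e, other e)) ` {e \<in> edges G. u \<in> ends G e}" using p(2) by blast
  next
    fix p assume "p \<in> (\<lambda>e. (e, other e)) ` {e \<in> edges G. u \<in> ends G e}"
    then obtain e where p: "p = (e, other e)" "e \<in> edges G" "u \<in> ends G e" by blast
    then obtain v where "ends G e = {u, v}" using ex by blast
    then show "p \<in> {(e, v). e \<in> edges G \<and> ends G e = {u, v}}" using p other by simp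
  qed
  have "(\<Sum>(e, v)\<in>{(e, v). e \<in> edges G \<and> ends G e = {u, v}}. f (e, v))
      = (\<Sum>e\<in>{e \<in> edges G. u \<in> ends G e}. f (e, other e))"
    unfolding set by (subst sum.reindex) (auto simp: inj_on_def)
  also have "\<dots> = (\<Sum>e\<in>{e \<in> edges G. u \<in> ends G e}. - f (e, u))"
  proof (rule sum.cong[OF refl])
    fix e assume "e \<in> {e \<in> edges G. u \<in> ends G e}"
    then obtain v where "e \<in> edges G" "ends G e = {u, v}" using ex by blast
    then show "f (e, other e) = - f (e, u)" using other[of e v] anti[of e u v] by simp
  qed
  also have "\<dots> = outflow G (\<lambda>e v. - f (e, v)) {u}"
    unfolding outflow_singleton using multigraph_finite[OF G] by (simp add: sum.inter_filter)
  finally show ?thesis .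
qed

lemma has_nowhere_zero_flow_iff_outflow:
  assumes G: "multigraph G"
  shows "has_nowhere_zero_flow G \<beta> \<longleftrightarrow>
    (\<exists>g. nowhere_zero_arcs G g \<and> (\<forall>u\<in>verts G. outflow G g {u} = \<beta> u))"
proof
  assume "has_nowhere_zero_flow G \<beta>"
  then obtain f where f: "Z3_flow G \<beta> f" and nz: "\<And>a. a \<in> symmetric_arcs G \<Longrightarrow> f a \<noteq> 0"
    unfolding has_nowhere_zero_flow_def by blast
  have anti: "\<And>e u v. e \<in> edges G \<Longrightarrow> ends G e = {u, v} \<Longrightarrow> f (e, u) = - f (e, v)"
    using f unfolding Z3_flow_def by blast
  have "nowhere_zero_arcs G (\<lambda>e v. - f (e, v))"
    unfolding nowhere_zero_arcs_def
  proof (intro ballI conjI)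
    fix e assume e: "e \<in> edges G"
    obtain u v where uv: "u \<noteq> v" "ends G e = {u, v}" using multigraph_edgeE[OF G e] by metis
    show "(\<Sum>v\<in>ends G e. - f (e, v)) = 0" using uv anti[OF e uv(2)] by simp
    show "- f (e, w) \<noteq> 0" if "w \<in> ends G e" for w
      using nz[of "(e, w)"] e that by (simp add: symmetric_arcs_def)
  qed
  moreover have "outflow G (\<lambda>e v. - f (e, v)) {u} = \<beta> u" if "u \<in> verts G" for u
    using arc_sum_eq_outflow[of G f u, OF G anti] f that unfolding Z3_flow_def by auto
  ultimately show "\<exists>g. nowhere_zero_arcs G g \<and> (\<forall>u\<in>verts G. outflow G g {u} = \<beta> u)" by blast
next
  assume "\<exists>g. nowhere_zero_arcs G g \<and> (\<forall>u\<in>verts G. outflow G g {u} = \<beta> u)"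
  then obtain g where g: "nowhere_zero_arcs G g" "\<And>u. u \<in> verts G \<Longrightarrow> outflow G g {u} = \<beta> u"
    by blast
  define f where "f = (\<lambda>(e, v). - g e v)"
  have anti: "f (e, u) = - f (e, v)" if "e \<in> edges G" "ends G e = {u, v}" for e u v
  proof -
    have "u \<noteq> v" by (rule multigraph_edgeE[OF G that(1)]) (use that(2) in auto)
    then have "g e u + g e v = 0" using g(1) that unfolding nowhere_zero_arcs_def by force
    then show ?thesis unfolding f_def by (simp add: add_eq_0_iff)
  qed
  have "(\<lambda>e v. - f (e, v)) = g" by (simp add: f_def)
  then have "Z3_flow G \<beta> f"
    unfolding Z3_flow_def using anti g(2) arc_sum_eq_outflow[of G f, OF G anti] by simp
  moreover have "f a \<noteq> 0" if "a \<in> symmetric_arcs G" for a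
    using g(1) that unfolding nowhere_zero_arcs_def symmetric_arcs_def f_def by auto
  ultimately show "has_nowhere_zero_flow G \<beta>" unfolding has_nowhere_zero_flow_def by blast
qed

lemma nowhere_zero_arcs_exist:
  assumes G: "multigraph G"
  obtains g where "nowhere_zero_arcs G g"
proof -
  have "\<exists>t. (\<Sum>v\<in>ends G e. t v) = 0 \<and> (\<forall>v\<in>ends G e. t v \<noteq> (0::3))" if "e \<in> edges G" for e
  proof -
    obtain u v where uv: "u \<noteq> v" "ends G e = {u, v}" using multigraph_edgeE[OF G \<open>e \<in> edges G\<close>] by metis
    then have "(\<Sum>w\<in>ends G e. if w = u then 1 else (- 1::3)) = 0" by simp
    moreover have "\<forall>w\<in>ends G e. (if w = u then 1 else (- 1::3)) \<noteq> 0" by simp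
    ultimately show ?thesis by blast
  qed
  then obtain g where "\<forall>e\<in>edges G. (\<Sum>v\<in>ends G e. g e v) = 0 \<and> (\<forall>v\<in>ends G e. g e v \<noteq> (0::3))"
    by metis
  then show thesis using that unfolding nowhere_zero_arcs_def by blast
qed

section \<open>Quotients as images under labellings\<close>

text \<open>\<open>K\<close> arises from \<open>H\<close> by identifying the vertices with equal label \<open>\<phi>\<close>,
  deleting the loops, and renaming the remaining edges by \<open>\<epsilon>\<close>. Having this as a
  relation between graphs of arbitrary types treats quotients, iterated quotients and
  renamings to natural numbers alike.\<close>

definition graph_image :: "('v \<Rightarrow> 'w) \<Rightarrow> ('e \<Rightarrow> 'f) \<Rightarrow> ('v, 'e) mgraph \<Rightarrow> ('w, 'f) mgraph \<Rightarrow> bool" where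
  "graph_image \<phi> \<epsilon> H K \<longleftrightarrow> verts K = \<phi> ` verts H \<and>
     bij_betw \<epsilon> {e\<in>edges H. inj_on \<phi> (ends H e)} (edges K) \<and>
     (\<forall>e\<in>edges H. inj_on \<phi> (ends H e) \<longrightarrow> ends K (\<epsilon> e) = \<phi> ` ends H e)"

abbreviation fibre :: "('v, 'e) mgraph \<Rightarrow> ('v \<Rightarrow> 'w) \<Rightarrow> 'w \<Rightarrow> 'v set" where
  "fibre H \<phi> w \<equiv> {v\<in>verts H. \<phi> v = w}"

text \<open>Existence of a nowhere-zero flow in the quotient by \<open>\<phi>\<close>, expressed inside
  \<open>H\<close>. Labels outside the image of \<open>\<phi>\<close> have an empty fibre and impose no condition.\<close>

definition flow_along :: "('v, 'e) mgraph \<Rightarrow> ('v \<Rightarrow> 'w) \<Rightarrow> ('v \<Rightarrow> 3) \<Rightarrow> bool" where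
  "flow_along H \<phi> \<beta> \<longleftrightarrow> (\<exists>g. nowhere_zero_arcs H g \<and>
     (\<forall>w. outflow H g (fibre H \<phi> w) = (\<Sum>v\<in>fibre H \<phi> w. \<beta> v)))"

lemma graph_imageD:
  assumes "graph_image \<phi> \<epsilon> H K"
  shows "verts K = \<phi> ` verts H"
    and "bij_betw \<epsilon> {e\<in>edges H. inj_on \<phi> (ends H e)} (edges K)"
    and "\<And>e. e \<in> edges H \<Longrightarrow> inj_on \<phi> (ends H e) \<Longrightarrow> ends K (\<epsilon> e) = \<phi> ` ends H e"
  using assms unfolding graph_image_def by simp_all

lemma graph_image_edge:
  assumes "graph_image \<phi> \<epsilon> H K" "i \<in> edges K"
  obtains e where "e \<in> edges H" "inj_on \<phi> (ends H e)" "i = \<epsilon> e" "ends K i = \<phi> ` ends H e"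
proof -
  have "i \<in> \<epsilon> ` {e\<in>edges H. inj_on \<phi> (ends H e)}"
    using bij_betw_imp_surj_on[OF graph_imageD(2)[OF assms(1)]] assms(2) by simp
  then show thesis using that graph_imageD(3)[OF assms(1)] by auto
qed

lemma graph_image_multigraph:
  assumes H: "multigraph H" and K: "graph_image \<phi> \<epsilon> H K"
  shows "multigraph K"
  unfolding multigraph_def
proof (intro conjI ballI)
  show "finite (verts K)"
    using K multigraph_finite[OF H] unfolding graph_image_def by simp
  have "finite {e\<in>edges H. inj_on \<phi> (ends H e)}" using multigraph_finite[OF H] by simp
  then show "finite (edges K)"
    using K bij_betw_finite unfolding graph_image_def by blast
  fix i assume "i \<in> edges K"
  then obtain e where e: "e \<in> edges H" "inj_on \<phi> (ends H e)" "ends K i = \<phi> ` ends H e"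
    using graph_image_edge[OF K] by metis
  obtain u v where uv: "u \<noteq> v" "u \<in> verts H" "v \<in> verts H" "ends H e = {u, v}"
    using multigraph_edgeE[OF H e(1)] .
  then have "\<phi> u \<noteq> \<phi> v" "ends K i = {\<phi> u, \<phi> v}" "\<phi> u \<in> verts K" "\<phi> v \<in> verts K"
    using e(2,3) graph_imageD(1)[OF K] by auto
  then show "\<exists>u\<in>verts K. \<exists>v\<in>verts K. u \<noteq> v \<and> ends K i = {u, v}" by blast
qed

lemma outflow_empty: "outflow G g {} = 0"
  by (simp add: outflow_def)

text \<open>A collapsed edge has both ends or no end in a given fibre, so it contributes
  nothing to the outflow of the fibre.\<close>

lemma graph_image_outflow:
  assumes H: "multigraph H" and K: "graph_image \<phi> \<epsilon> H K" and g: "nowhere_zero_arcs H g"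
    and h: "\<And>e v. e \<in> edges H \<Longrightarrow> inj_on \<phi> (ends H e) \<Longrightarrow> v \<in> ends H e \<Longrightarrow> h (\<epsilon> e) (\<phi> v) = g e v"
  shows "outflow K h {w} = outflow H g (fibre H \<phi> w)"
proof -
  let ?N = "{e\<in>edges H. inj_on \<phi> (ends H e)}"
  have bij: "bij_betw \<epsilon> ?N (edges K)" by (rule graph_imageD(2)[OF K])
  have "outflow K h {w} = (\<Sum>e\<in>?N. if w \<in> ends K (\<epsilon> e) then h (\<epsilon> e) w else 0)"
    unfolding outflow_singleton by (rule sum.reindex_bij_betw[OF bij, symmetric])
  also have "\<dots> = (\<Sum>e\<in>?N. \<Sum>v\<in>ends H e \<inter> fibre H \<phi> w. g e v)"
  proof (rule sum.cong[OF refl])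
    fix e assume e: "e \<in> ?N"
    then have K_ends: "ends K (\<epsilon> e) = \<phi> ` ends H e" using graph_imageD(3)[OF K] by simp
    have V: "ends H e \<subseteq> verts H" using ends_verts[OF H] e by simp
    show "(if w \<in> ends K (\<epsilon> e) then h (\<epsilon> e) w else 0) = (\<Sum>v\<in>ends H e \<inter> fibre H \<phi> w. g e v)"
    proof (cases "w \<in> \<phi> ` ends H e")
      case True
      then obtain v where v: "v \<in> ends H e" "\<phi> v = w" by blast
      then have "ends H e \<inter> fibre H \<phi> w = {v}" using V e by (auto dest: inj_onD)
      then show ?thesis using v e h[of e v] K_ends by auto
    next
      case False
      then have "ends H e \<inter> fibre H \<phi> w = {}" by blast
      then show ?thesis using False K_ends by (simp only: sum.empty if_False)
    qed
  qed
  also have "\<dots> = outflow H g (fibre H \<phi> w)"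
    unfolding outflow_def
  proof (rule sum.mono_neutral_left)
    show "finite (edges H)" using multigraph_finite[OF H] by simp
    show "\<forall>e\<in>edges H - ?N. (\<Sum>v\<in>ends H e \<inter> fibre H \<phi> w. g e v) = 0"
    proof
      fix e assume e: "e \<in> edges H - ?N"
      then obtain a b where ab: "a \<noteq> b" "a \<in> verts H" "b \<in> verts H" "ends H e = {a, b}"
        using multigraph_edgeE[OF H, of e] by blast
      have "\<phi> a = \<phi> b" using e ab by auto
      then have "ends H e \<inter> fibre H \<phi> w = ends H e \<or> ends H e \<inter> fibre H \<phi> w = {}"
        using ab by auto
      then show "(\<Sum>v\<in>ends H e \<inter> fibre H \<phi> w. g e v) = 0"
        using g e unfolding nowhere_zero_arcs_def by force
    qed
  qed auto
  finally show ?thesis .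
qed

text \<open>Edges that become loops do not affect the outflow of fibres, so they may be given
  arbitrary nonzero values when a flow of the image is pulled back.\<close>

lemma graph_image_flow_iff:
  assumes H: "multigraph H" and K: "graph_image \<phi> \<epsilon> H K"
    and \<gamma>: "\<And>w. w \<in> verts K \<Longrightarrow> \<gamma> w = (\<Sum>v\<in>fibre H \<phi> w. \<beta> v)"
  shows "has_nowhere_zero_flow K \<gamma> \<longleftrightarrow> flow_along H \<phi> \<beta>"
proof -
  let ?N = "{e\<in>edges H. inj_on \<phi> (ends H e)}"
  have bij: "bij_betw \<epsilon> ?N (edges K)" by (rule graph_imageD(2)[OF K])
  have mK: "multigraph K" by (rule graph_image_multigraph[OF H K])
  have out: "fibre H \<phi> w = {}" if "w \<notin> verts K" for w
    using that graph_imageD(1)[OF K] by auto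
  have reindex: "(\<Sum>w\<in>ends K (\<epsilon> e). h (\<epsilon> e) w) = (\<Sum>v\<in>ends H e. h (\<epsilon> e) (\<phi> v))"
    if "e \<in> ?N" for e and h :: "_ \<Rightarrow> _ \<Rightarrow> 3"
    using that graph_imageD(3)[OF K] by (simp add: sum.reindex)
  show ?thesis
  proof
    assume "has_nowhere_zero_flow K \<gamma>"
    then obtain h where h: "nowhere_zero_arcs K h" "\<And>w. w \<in> verts K \<Longrightarrow> outflow K h {w} = \<gamma> w"
      unfolding has_nowhere_zero_flow_iff_outflow[OF mK] by blast
    obtain g0 where g0: "nowhere_zero_arcs H g0" using nowhere_zero_arcs_exist[OF H] .
    define g where "g e v = (if e \<in> ?N then h (\<epsilon> e) (\<phi> v) else g0 e v)" for e v
    have g: "nowhere_zero_arcs H g"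
      unfolding nowhere_zero_arcs_def
    proof (intro ballI)
      fix e assume e: "e \<in> edges H"
      show "(\<Sum>v\<in>ends H e. g e v) = 0 \<and> (\<forall>v\<in>ends H e. g e v \<noteq> 0)"
      proof (cases "e \<in> ?N")
        case True
        then have "\<epsilon> e \<in> edges K" using bij bij_betwE by blast
        moreover have "ends K (\<epsilon> e) = \<phi> ` ends H e" using True graph_imageD(3)[OF K] by simp
        moreover have "(\<Sum>w\<in>ends K (\<epsilon> e). h (\<epsilon> e) w) = 0"
            "\<And>w. w \<in> ends K (\<epsilon> e) \<Longrightarrow> h (\<epsilon> e) w \<noteq> 0"
          using h(1) \<open>\<epsilon> e \<in> edges K\<close> unfolding nowhere_zero_arcs_def by blast+
        ultimately show ?thesis
          using True reindex[OF True, of h] unfolding g_def by simp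
      next
        case False
        then show ?thesis using g0 e unfolding nowhere_zero_arcs_def g_def by simp
      qed
    qed
    have hg: "outflow K h {w} = outflow H g (fibre H \<phi> w)" for w
      by (rule graph_image_outflow[OF H K g]) (simp add: g_def)
    have "outflow H g (fibre H \<phi> w) = (\<Sum>v\<in>fibre H \<phi> w. \<beta> v)" for w
    proof (cases "w \<in> verts K")
      case True
      then show ?thesis using hg[of w] h(2) \<gamma> by simp
    next
      case False
      show ?thesis unfolding out[OF False] by (simp add: outflow_empty)
    qed
    then show "flow_along H \<phi> \<beta>" using g unfolding flow_along_def by blast
  next
    assume "flow_along H \<phi> \<beta>"
    then obtain g where g: "nowhere_zero_arcs H g"
      "\<And>w. outflow H g (fibre H \<phi> w) = (\<Sum>v\<in>fibre H \<phi> w. \<beta> v)"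
      unfolding flow_along_def by blast
    define src where "src = the_inv_into ?N \<epsilon>"
    define h where "h i w = g (src i) (the_inv_into (ends H (src i)) \<phi> w)" for i w
    have h: "h (\<epsilon> e) (\<phi> v) = g e v" if "e \<in> edges H" "inj_on \<phi> (ends H e)" "v \<in> ends H e" for e v
    proof -
      have "src (\<epsilon> e) = e"
        unfolding src_def using bij that by (intro the_inv_into_f_f) (auto simp: bij_betw_def)
      then show ?thesis unfolding h_def using that by (simp add: the_inv_into_f_f)
    qed
    have "nowhere_zero_arcs K h"
      unfolding nowhere_zero_arcs_def
    proof (intro ballI)
      fix i assume "i \<in> edges K"
      then obtain e where e: "e \<in> edges H" "inj_on \<phi> (ends H e)" "i = \<epsilon> e" "ends K i = \<phi> ` ends H e"
        by (rule graph_image_edge[OF K])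
      have "(\<Sum>w\<in>ends K i. h i w) = (\<Sum>v\<in>ends H e. g e v)"
        using reindex[of e h] h e by simp
      then show "(\<Sum>w\<in>ends K i. h i w) = 0 \<and> (\<forall>w\<in>ends K i. h i w \<noteq> 0)"
        using g(1) e h unfolding nowhere_zero_arcs_def by auto
    qed
    moreover have "outflow K h {w} = \<gamma> w" if "w \<in> verts K" for w
      using graph_image_outflow[OF H K g(1) h, of w] g(2)[of w] \<gamma>[OF that] by simp
    ultimately show "has_nowhere_zero_flow K \<gamma>"
      unfolding has_nowhere_zero_flow_iff_outflow[OF mK] by blast
  qed
qed

text \<open>The labelling whose image is the quotient by a partition.\<close>

definition part_of :: "'v set set \<Rightarrow> 'v \<Rightarrow> 'v set" where
  "part_of \<P> v = (THE P. P \<in> \<P> \<and> v \<in> P)"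

lemma part_of_eq:
  assumes "partition_on V \<P>" "P \<in> \<P>" "v \<in> P"
  shows "part_of \<P> v = P"
  unfolding part_of_def
  using assms partition_onD2[OF assms(1)] by (intro the_equality) (auto dest: disjointD)

lemma part_of_mem:
  assumes "partition_on V \<P>" "v \<in> V"
  shows "part_of \<P> v \<in> \<P>" "v \<in> part_of \<P> v"
proof -
  obtain P where "P \<in> \<P>" "v \<in> P" using assms partition_onD1 by blast
  then show "part_of \<P> v \<in> \<P>" "v \<in> part_of \<P> v" using part_of_eq[OF assms(1)] by metis+
qed

lemma fibre_part_of:
  assumes "partition_on (verts G) \<P>" "P \<in> \<P>"
  shows "fibre G (part_of \<P>) P = P"
proof -
  have "P \<subseteq> verts G" using assms partition_onD1 by blast
  show ?thesis
  proof (intro equalityI subsetI)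
    fix v assume "v \<in> fibre G (part_of \<P>) P"
    then show "v \<in> P" using part_of_mem(2)[OF assms(1), of v] by simp
  next
    fix v assume "v \<in> P"
    then show "v \<in> fibre G (part_of \<P>) P" using \<open>P \<subseteq> verts G\<close> part_of_eq[OF assms, of v] by auto
  qed
qed

lemma quotient_graph_image:
  assumes \<P>: "partition_on (verts K) \<P>" and H: "multigraph H" and K: "graph_image \<phi> \<epsilon> H K"
  shows "graph_image (part_of \<P> \<circ> \<phi>) \<epsilon> H (quotient_graph K \<P>)"
proof -
  have mK: "multigraph K" by (rule graph_image_multigraph[OF H K])
  have V: "part_of \<P> ` verts K = \<P>"
  proof (intro equalityI subsetI)
    fix P assume P: "P \<in> \<P>"
    then obtain v where "v \<in> P" using partition_onD3[OF \<P>] by (metis ex_in_conv)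
    moreover have "v \<in> verts K" using P \<open>v \<in> P\<close> partition_onD1[OF \<P>] by blast
    ultimately show "P \<in> part_of \<P> ` verts K" using part_of_eq[OF \<P> P] by blast
  qed (use part_of_mem[OF \<P>] in auto)
  have inj: "inj_on (part_of \<P>) (ends K i) \<longleftrightarrow> (\<forall>P\<in>\<P>. \<not> ends K i \<subseteq> P)" if "i \<in> edges K" for i
  proof -
    obtain a b where ab: "a \<noteq> b" "a \<in> verts K" "b \<in> verts K" "ends K i = {a, b}"
      using multigraph_edgeE[OF mK \<open>i \<in> edges K\<close>] .
    have "part_of \<P> a = part_of \<P> b \<longleftrightarrow> (\<exists>P\<in>\<P>. a \<in> P \<and> b \<in> P)"
      using part_of_mem[OF \<P>] part_of_eq[OF \<P>] ab by metis
    then show ?thesis using ab by auto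
  qed
  have ends: "{P\<in>\<P>. ends K i \<inter> P \<noteq> {}} = part_of \<P> ` ends K i" if "i \<in> edges K" for i
  proof (intro equalityI subsetI)
    fix P assume "P \<in> {P\<in>\<P>. ends K i \<inter> P \<noteq> {}}"
    then obtain v where "P \<in> \<P>" "v \<in> ends K i" "v \<in> P" by blast
    then show "P \<in> part_of \<P> ` ends K i" using part_of_eq[OF \<P>] by blast
  next
    fix P assume "P \<in> part_of \<P> ` ends K i"
    then obtain v where v: "v \<in> ends K i" "P = part_of \<P> v" by blast
    then have "v \<in> verts K" using ends_verts[OF mK \<open>i \<in> edges K\<close>] by blast
    then show "P \<in> {P\<in>\<P>. ends K i \<inter> P \<noteq> {}}" using v part_of_mem[OF \<P>] by blast
  qed
  have bij: "bij_betw \<epsilon> {e\<in>edges H. inj_on \<phi> (ends H e)} (edges K)"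
    and VK: "verts K = \<phi> ` verts H"
    and eK: "\<And>e. e \<in> edges H \<Longrightarrow> inj_on \<phi> (ends H e) \<Longrightarrow> ends K (\<epsilon> e) = \<phi> ` ends H e"
    by (fact graph_imageD[OF K])+
  have comp: "inj_on (part_of \<P> \<circ> \<phi>) (ends H e) \<longleftrightarrow>
      inj_on \<phi> (ends H e) \<and> (\<forall>P\<in>\<P>. \<not> ends K (\<epsilon> e) \<subseteq> P)" if "e \<in> edges H" for e
  proof (cases "inj_on \<phi> (ends H e)")
    case True
    then have "\<epsilon> e \<in> edges K" using bij_betwE[OF bij] that by blast
    then show ?thesis using inj[of "\<epsilon> e"] eK[OF that True] True comp_inj_on_iff[OF True] by metis
  next
    case False
    then show ?thesis by (metis inj_on_imageI2)
  qed
  have "bij_betw \<epsilon> {e\<in>edges H. inj_on (part_of \<P> \<circ> \<phi>) (ends H e)} (edges (quotient_graph K \<P>))"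
    unfolding bij_betw_def
  proof
    show "inj_on \<epsilon> {e\<in>edges H. inj_on (part_of \<P> \<circ> \<phi>) (ends H e)}"
      by (rule inj_on_subset[OF bij_betw_imp_inj_on[OF bij]]) (use comp in blast)
    show "\<epsilon> ` {e\<in>edges H. inj_on (part_of \<P> \<circ> \<phi>) (ends H e)} = edges (quotient_graph K \<P>)"
    proof -
      have "{e\<in>edges H. inj_on (part_of \<P> \<circ> \<phi>) (ends H e)} =
          {e \<in> {e\<in>edges H. inj_on \<phi> (ends H e)}. \<forall>P\<in>\<P>. \<not> ends K (\<epsilon> e) \<subseteq> P}"
        using comp by blast
      then show ?thesis
        unfolding quotient_graph_def by (auto simp: bij_betw_imp_surj_on[OF bij, symmetric])
    qed
  qed
  moreover have "ends (quotient_graph K \<P>) (\<epsilon> e) = (part_of \<P> \<circ> \<phi>) ` ends H e"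
    if "e \<in> edges H" "inj_on (part_of \<P> \<circ> \<phi>) (ends H e)" for e
  proof -
    have "inj_on \<phi> (ends H e)" using comp that by blast
    then have "\<epsilon> e \<in> edges K" "ends K (\<epsilon> e) = \<phi> ` ends H e" using bij_betwE[OF bij] that eK by blast+
    then show ?thesis using ends[of "\<epsilon> e"] by (simp add: quotient_graph_def image_comp)
  qed
  moreover have "verts (quotient_graph K \<P>) = (part_of \<P> \<circ> \<phi>) ` verts H"
    using V VK by (simp add: quotient_graph_def image_comp)
  ultimately show ?thesis unfolding graph_image_def by blast
qed

lemma graph_image_id: "graph_image id id G G"
  unfolding graph_image_def by (auto simp: bij_betw_def)

section \<open>Extending flows from a vertex subset\<close>

definition inner :: "('v, 'e) mgraph \<Rightarrow> 'v set \<Rightarrow> 'e set" where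
  "inner G A = {e\<in>edges G. ends G e \<subseteq> A}"

lemma inner_singleton:
  assumes "multigraph G"
  shows "inner G {v} = {}"
proof -
  have "\<not> ends G e \<subseteq> {v}" if "e \<in> edges G" for e
    by (rule multigraph_edgeE[OF assms that]) auto
  then show ?thesis unfolding inner_def by blast
qed

lemma finite_inner: "multigraph G \<Longrightarrow> finite (inner G A)"
  unfolding inner_def by (simp add: multigraph_finite(2))

lemma multigraph_induced:
  assumes G: "multigraph G" and A: "A \<subseteq> verts G"
  shows "multigraph (induced_subgraph G A)"
proof -
  have "\<exists>u\<in>A. \<exists>v\<in>A. u \<noteq> v \<and> ends G e = {u, v}" if "e \<in> edges G" "ends G e \<subseteq> A" for e
    by (rule multigraph_edgeE[OF G that(1)]) (use that(2) in auto)
  then show ?thesis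
    using multigraph_finite[OF G] finite_subset[OF A]
    unfolding multigraph_def induced_subgraph_def by auto
qed

lemma outflow_inner_split:
  assumes G: "multigraph G"
  shows "outflow G g X = outflow (induced_subgraph G A) g X + outflow (delete_edges G (inner G A)) g X"
proof -
  have sub: "inner G A \<subseteq> edges G" unfolding inner_def by blast
  show ?thesis
    unfolding outflow_def induced_subgraph_def delete_edges_def inner_def[symmetric]
    using sum.subset_diff[OF sub multigraph_finite(2)[OF G]] by (simp add: add.commute inner_def)
qed

text \<open>What the edges inside \<open>A\<close> still have to contribute if all other edges keep their
  values \<open>g\<close>.\<close>

definition residual_boundary ::
    "('v, 'e) mgraph \<Rightarrow> ('v \<Rightarrow> 3) \<Rightarrow> 'v set \<Rightarrow> ('e \<Rightarrow> 'v \<Rightarrow> 3) \<Rightarrow> 'v \<Rightarrow> 3" where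
  "residual_boundary G \<beta> A g u = \<beta> u - outflow (delete_edges G (inner G A)) g {u}"

lemma flow_extend:
  assumes G: "multigraph G" and A: "A \<subseteq> verts G" and g: "nowhere_zero_arcs G g"
    and off: "\<And>u. u \<in> verts G - A \<Longrightarrow> outflow G g {u} = \<beta> u"
    and on: "has_nowhere_zero_flow (induced_subgraph G A) (residual_boundary G \<beta> A g)"
  shows "has_nowhere_zero_flow G \<beta>"
proof -
  let ?I = "induced_subgraph G A" and ?D = "delete_edges G (inner G A)"
  obtain h where h: "nowhere_zero_arcs ?I h"
      "\<And>u. u \<in> A \<Longrightarrow> outflow ?I h {u} = \<beta> u - outflow ?D g {u}"
    using on unfolding has_nowhere_zero_flow_iff_outflow[OF multigraph_induced[OF G A]]
      residual_boundary_def by (auto simp: induced_subgraph_def)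
  define k where "k e = (if e \<in> inner G A then h e else g e)" for e
  have "nowhere_zero_arcs G k"
    using g h(1) unfolding nowhere_zero_arcs_def k_def induced_subgraph_def inner_def by simp
  moreover have "outflow G k {u} = \<beta> u" if u: "u \<in> verts G" for u
  proof -
    have D: "outflow ?D k {u} = outflow ?D g {u}"
      unfolding outflow_def by (rule sum.cong) (auto simp: k_def delete_edges_def)
    have I: "outflow ?I k {u} = outflow ?I h {u}"
      unfolding outflow_def by (rule sum.cong) (auto simp: k_def induced_subgraph_def inner_def)
    show ?thesis
    proof (cases "u \<in> A")
      case True
      then show ?thesis using outflow_inner_split[OF G, of k "{u}" A] D I h(2)[OF True] by simp
    next
      case False
      have no: "outflow ?I f {u} = 0" for f
        unfolding outflow_def induced_subgraph_def using False by (intro sum.neutral) (auto intro: sum.neutral)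
      show ?thesis
        using outflow_inner_split[OF G, of k "{u}" A] outflow_inner_split[OF G, of g "{u}" A]
          D no off[of u] u False by simp
    qed
  qed
  ultimately show ?thesis unfolding has_nowhere_zero_flow_iff_outflow[OF G] by blast
qed

text \<open>The outflow of the whole graph is zero, and so is the total of \<open>\<beta>\<close>; so
  correct outflow off \<open>A\<close> forces correct total outflow of \<open>A\<close>, and to that total the edges
  inside \<open>A\<close> contribute nothing.\<close>

lemma residual_boundary_sum:
  assumes G: "multigraph G" and A: "A \<subseteq> verts G" and g: "nowhere_zero_arcs G g"
    and off: "\<And>u. u \<in> verts G - A \<Longrightarrow> outflow G g {u} = \<beta> u"
    and zero: "(\<Sum>v\<in>verts G. \<beta> v) = 0"
  shows "(\<Sum>u\<in>A. residual_boundary G \<beta> A g u) = 0"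
proof -
  let ?I = "induced_subgraph G A" and ?D = "delete_edges G (inner G A)"
  have fin: "finite (verts G)" "finite A" using multigraph_finite[OF G] finite_subset[OF A] by auto
  have "nowhere_zero_arcs ?I g"
    using g unfolding nowhere_zero_arcs_def induced_subgraph_def by simp
  then have I: "outflow ?I g A = 0"
    using outflow_verts[OF multigraph_induced[OF G A]] by (simp add: induced_subgraph_def)
  have "0 = outflow G g (verts G)" using outflow_verts[OF G g] by simp
  also have "\<dots> = (\<Sum>u\<in>verts G - A. outflow G g {u}) + (\<Sum>u\<in>A. outflow G g {u})"
    using outflow_sum[OF fin(1)] sum.subset_diff[OF A fin(1)] by metis
  also have "(\<Sum>u\<in>verts G - A. outflow G g {u}) = (\<Sum>u\<in>verts G - A. \<beta> u)"
    by (rule sum.cong[OF refl off])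
  also have "(\<Sum>u\<in>A. outflow G g {u}) = outflow G g A" using outflow_sum[OF fin(2)] by metis
  finally have "(\<Sum>u\<in>verts G - A. \<beta> u) = - outflow G g A" by (simp add: eq_neg_iff_add_eq_0)
  moreover have "(\<Sum>u\<in>verts G - A. \<beta> u) + (\<Sum>u\<in>A. \<beta> u) = 0"
    using sum.subset_diff[OF A fin(1), of \<beta>] zero by simp
  ultimately have "(\<Sum>u\<in>A. \<beta> u) = outflow G g A" by (simp add: add_eq_0_iff)
  also have "\<dots> = outflow ?D g A" using outflow_inner_split[OF G, of g A A] I by simp
  also have "\<dots> = (\<Sum>u\<in>A. outflow ?D g {u})" by (rule outflow_sum[OF fin(2)])
  finally show ?thesis unfolding residual_boundary_def by (simp add: sum_subtractf)
qed

text \<open>If \<open>G\<close> has no flow, then arc values that are correct off \<open>A\<close> pass the obstruction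
  on to \<open>G[A]\<close>. This is used for contractions, for the deletion of a vertex, and for
  merging the ends of two parallel edges.\<close>

lemma no_flow_inside:
  assumes "multigraph G" "A \<subseteq> verts G" "nowhere_zero_arcs G g"
    and "\<And>u. u \<in> verts G - A \<Longrightarrow> outflow G g {u} = \<beta> u"
    and "(\<Sum>v\<in>verts G. \<beta> v) = 0" "\<not> has_nowhere_zero_flow G \<beta>"
  obtains \<beta>' where "(\<Sum>v\<in>A. \<beta>' v) = 0" "\<not> has_nowhere_zero_flow (induced_subgraph G A) \<beta>'"
  using that residual_boundary_sum[OF assms(1-5)] flow_extend[OF assms(1-4)] assms(6) by blast

section \<open>Parallel edges and splitting off\<close>

text \<open>All edges but \<open>e\<close> and \<open>f\<close> may take arbitrary nonzero values; these two then
  compensate.\<close>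

lemma two_parallel_edges_flow:
  assumes G: "multigraph G" and V: "verts G = {x, y}" "x \<noteq> y"
    and e: "e \<in> edges G" "f \<in> edges G" "e \<noteq> f" and \<beta>: "\<beta> x + \<beta> y = 0"
  shows "has_nowhere_zero_flow G \<beta>"
proof -
  have ends: "ends G i = {x, y}" if "i \<in> edges G" for i
    by (rule multigraph_edgeE[OF G that]) (use V in auto)
  obtain g0 where g0: "nowhere_zero_arcs G g0" using nowhere_zero_arcs_exist[OF G] .
  define d where "d = \<beta> x - (\<Sum>i\<in>edges G - {e, f}. g0 i x)"
  obtain a b where ab: "a \<noteq> 0" "b \<noteq> 0" "a + b = d" using Z3_sum_of_two_nonzero by blast
  define g where "g i v = (if i = e then if v = x then a else - a
    else if i = f then if v = x then b else - b else g0 i v)" for i v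
  have g: "nowhere_zero_arcs G g"
    unfolding nowhere_zero_arcs_def
  proof (intro ballI)
    fix i assume i: "i \<in> edges G"
    have "(\<Sum>v\<in>ends G i. g0 i v) = 0 \<and> (\<forall>v\<in>ends G i. g0 i v \<noteq> 0)"
      using g0 i unfolding nowhere_zero_arcs_def by blast
    then show "(\<Sum>v\<in>ends G i. g i v) = 0 \<and> (\<forall>v\<in>ends G i. g i v \<noteq> 0)"
      unfolding g_def ends[OF i] using ab V(2) by auto
  qed
  have "outflow G g {x} = (\<Sum>i\<in>edges G. g i x)"
    unfolding outflow_singleton by (rule sum.cong) (use ends in auto)
  also have "\<dots> = (\<Sum>i\<in>edges G - {e, f}. g i x) + (\<Sum>i\<in>{e, f}. g i x)"
    by (rule sum.subset_diff) (use e multigraph_finite[OF G] in auto)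
  also have "(\<Sum>i\<in>edges G - {e, f}. g i x) = (\<Sum>i\<in>edges G - {e, f}. g0 i x)"
    by (rule sum.cong) (auto simp: g_def)
  also have "(\<Sum>i\<in>{e, f}. g i x) = d" using e(3) ab(3) by (simp add: g_def)
  finally have x: "outflow G g {x} = \<beta> x" by (simp add: d_def)
  have "outflow G g {x} + outflow G g {y} = 0"
    using outflow_verts[OF G g] outflow_sum[of "{x, y}" G g] V by simp
  then have "outflow G g {y} = \<beta> y" using x \<beta> by (metis add_left_cancel)
  with x g V(1) show ?thesis unfolding has_nowhere_zero_flow_iff_outflow[OF G] by auto
qed

text \<open>Contracting a pair of vertices joined by two parallel edges does not create flows:
  whatever boundary remains at the pair, the two edges can realize it.\<close>

lemma merge_parallel_flow:
  assumes G: "multigraph G" and e: "e \<in> edges G" "f \<in> edges G" "e \<noteq> f"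
    and ends: "ends G e = {x, y}" "ends G f = {x, y}"
    and zero: "(\<Sum>v\<in>verts G. \<beta> v) = 0"
    and along: "flow_along G (\<lambda>v. if v = y then x else v) \<beta>"
  shows "has_nowhere_zero_flow G \<beta>"
proof (rule ccontr)
  assume no: "\<not> has_nowhere_zero_flow G \<beta>"
  let ?\<phi> = "\<lambda>v. if v = y then x else v"
  have xy: "x \<noteq> y" "{x, y} \<subseteq> verts G"
    by (rule multigraph_edgeE[OF G e(1)], use ends(1) in auto)+
  obtain g where g: "nowhere_zero_arcs G g"
      "\<And>w. outflow G g (fibre G ?\<phi> w) = (\<Sum>v\<in>fibre G ?\<phi> w. \<beta> v)"
    using along unfolding flow_along_def by blast
  have "outflow G g {u} = \<beta> u" if "u \<in> verts G - {x, y}" for u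
  proof -
    have "fibre G ?\<phi> u = {u}" using that by auto
    then show ?thesis using g(2)[of u] by simp
  qed
  then obtain \<beta>' where \<beta>': "(\<Sum>v\<in>{x, y}. \<beta>' v) = 0"
      "\<not> has_nowhere_zero_flow (induced_subgraph G {x, y}) \<beta>'"
    using no_flow_inside[OF G xy(2) g(1) _ zero no] by blast
  have "has_nowhere_zero_flow (induced_subgraph G {x, y}) \<beta>'"
    by (rule two_parallel_edges_flow[OF multigraph_induced[OF G xy(2)], of x y e f])
      (use e ends xy \<beta>'(1) in \<open>auto simp: induced_subgraph_def\<close>)
  with \<beta>'(2) show False by blast
qed

text \<open>Splitting off two edges \<open>e = zx\<close> and \<open>f = zy\<close>: the new edge \<open>xy\<close> takes over the
  name \<open>e\<close>.\<close>

definition lift :: "('v, 'e) mgraph \<Rightarrow> 'e \<Rightarrow> 'e \<Rightarrow> 'v \<Rightarrow> 'v \<Rightarrow> ('v, 'e) mgraph" where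
  "lift G e f x y = \<lparr>verts = verts G, edges = edges G - {f}, ends = (ends G)(e := {x, y})\<rparr>"

lemma multigraph_lift:
  assumes G: "multigraph G" and "x \<in> verts G" "y \<in> verts G" "x \<noteq> y"
  shows "multigraph (lift G e f x y)"
  using assms unfolding multigraph_def lift_def by auto

text \<open>A value sent along the new edge from \<open>x\<close> to \<open>y\<close> is sent from \<open>x\<close> to \<open>z\<close> along \<open>e\<close>
  and on to \<open>y\<close> along \<open>f\<close>; at \<open>z\<close> the two contributions cancel.\<close>

lemma lift_flow:
  assumes G: "multigraph G" and e: "e \<in> edges G" "f \<in> edges G" "e \<noteq> f"
    and ends: "ends G e = {z, x}" "ends G f = {z, y}" and xy: "x \<noteq> y"
    and flow: "has_nowhere_zero_flow (lift G e f x y) \<beta>"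
  shows "has_nowhere_zero_flow G \<beta>"
proof -
  let ?L = "lift G e f x y"
  have x: "z \<noteq> x" "x \<in> verts G" by (rule multigraph_edgeE[OF G e(1)], use ends(1) in auto)+
  have y: "z \<noteq> y" "y \<in> verts G" by (rule multigraph_edgeE[OF G e(2)], use ends(2) in auto)+
  have L: "multigraph ?L" by (rule multigraph_lift[OF G x(2) y(2) xy])
  obtain h where h: "nowhere_zero_arcs ?L h" "\<And>u. u \<in> verts G \<Longrightarrow> outflow ?L h {u} = \<beta> u"
    using flow unfolding has_nowhere_zero_flow_iff_outflow[OF L] by (auto simp: lift_def)
  define g where "g i v = (if i = e then if v = z then - h e x else h e x
    else if i = f then if v = z then - h e y else h e y else h i v)" for i v
  have "e \<in> edges ?L" "ends ?L e = {x, y}" using e by (auto simp: lift_def)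
  then have he: "h e x + h e y = 0" "h e x \<noteq> 0" "h e y \<noteq> 0"
    using h(1) xy unfolding nowhere_zero_arcs_def by fastforce+
  have "nowhere_zero_arcs G g"
    unfolding nowhere_zero_arcs_def
  proof (intro ballI)
    fix i assume i: "i \<in> edges G"
    show "(\<Sum>v\<in>ends G i. g i v) = 0 \<and> (\<forall>v\<in>ends G i. g i v \<noteq> 0)"
    proof (cases "i = e \<or> i = f")
      case True
      then show ?thesis using ends x y he e(3) by (auto simp: g_def)
    next
      case False
      then have "i \<in> edges ?L" "ends ?L i = ends G i" using i by (auto simp: lift_def)
      then show ?thesis using h(1) False unfolding nowhere_zero_arcs_def by (auto simp: g_def)
    qed
  qed
  moreover have "outflow G g {u} = \<beta> u" if u: "u \<in> verts G" for u
  proof -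
    let ?R = "edges G - {e, f}"
    have fin: "finite (edges G)" "finite (edges G - {f})" using multigraph_finite[OF G] by auto
    have "outflow G g {u} = (\<Sum>i\<in>?R. if u \<in> ends G i then g i u else 0)
        + (\<Sum>i\<in>{e, f}. if u \<in> ends G i then g i u else 0)"
      unfolding outflow_singleton by (rule sum.subset_diff) (use e fin in auto)
    also have "(\<Sum>i\<in>?R. if u \<in> ends G i then g i u else 0) =
        (\<Sum>i\<in>?R. if u \<in> ends ?L i then h i u else 0)"
      by (rule sum.cong) (auto simp: g_def lift_def)
    also have "(\<Sum>i\<in>{e, f}. if u \<in> ends G i then g i u else 0) =
        (\<Sum>i\<in>{e}. if u \<in> ends ?L i then h i u else 0)"
      using e(3) ends x(1) y(1) xy he(1) by (auto simp: g_def lift_def add_eq_0_iff)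
    also have "(\<Sum>i\<in>?R. if u \<in> ends ?L i then h i u else 0) +
        (\<Sum>i\<in>{e}. if u \<in> ends ?L i then h i u else 0) = outflow ?L h {u}"
    proof -
      have "?R = edges ?L - {e}" "{e} \<subseteq> edges ?L" "finite (edges ?L)"
        using e fin by (auto simp: lift_def)
      then show ?thesis unfolding outflow_singleton by (simp only: sum.subset_diff)
    qed
    finally show ?thesis using h(2)[OF u] by simp
  qed
  ultimately show ?thesis unfolding has_nowhere_zero_flow_iff_outflow[OF G] by blast
qed

section \<open>Connectivity\<close>

lemma disconnected_separation:
  assumes "verts G \<noteq> {}" "\<not> connected_graph G" "multigraph G"
  obtains S where "S \<noteq> {}" "S \<subset> verts G"
    "\<And>e. e \<in> edges G \<Longrightarrow> ends G e \<subseteq> S \<or> ends G e \<subseteq> verts G - S"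
proof -
  obtain u v where uv: "u \<in> verts G" "v \<in> verts G" "\<not> (adjacent G)\<^sup>*\<^sup>* u v"
    using assms(1,2) unfolding connected_graph_def by blast
  define S where "S = {w\<in>verts G. (adjacent G)\<^sup>*\<^sup>* u w}"
  have "u \<in> S" "v \<notin> S" "S \<subseteq> verts G" using uv unfolding S_def by auto
  moreover have "ends G e \<subseteq> S \<or> ends G e \<subseteq> verts G - S" if e: "e \<in> edges G" for e
  proof -
    obtain a b where ab: "a \<in> verts G" "b \<in> verts G" "ends G e = {a, b}"
      using multigraph_edgeE[OF assms(3) e] by metis
    have "adjacent G a b" "adjacent G b a"
      using e ab(3) unfolding adjacent_def by (auto simp: insert_commute)
    then have "a \<in> S \<longleftrightarrow> b \<in> S"
      using ab unfolding S_def by (auto intro: rtranclp.rtrancl_into_rtrancl)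
    then show ?thesis using ab by auto
  qed
  ultimately show thesis using that[of S] uv by blast
qed

lemma connected_components:
  assumes "connected_graph G"
  shows "components G = {verts G}"
proof -
  have "{w\<in>verts G. (adjacent G)\<^sup>*\<^sup>* v w} = verts G" if "v \<in> verts G" for v
    using assms that unfolding connected_graph_def by blast
  then show ?thesis using assms unfolding components_def connected_graph_def by auto
qed

section \<open>The density estimate\<close>

text \<open>Only the fibres of a labelling matter. This allows all labellings to take natural
  numbers as values, so that a coarsest one can be chosen.\<close>

lemma flow_along_comp_inj:
  assumes h: "inj_on h (\<phi> ` verts H)" and flow: "flow_along H (h \<circ> \<phi>) \<beta>"
  shows "flow_along H \<phi> \<beta>"
proof -
  obtain g where g: "nowhere_zero_arcs H g"
      "\<And>w. outflow H g (fibre H (h \<circ> \<phi>) w) = (\<Sum>v\<in>fibre H (h \<circ> \<phi>) w. \<beta> v)"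
    using flow unfolding flow_along_def by blast
  have "outflow H g (fibre H \<phi> w) = (\<Sum>v\<in>fibre H \<phi> w. \<beta> v)" for w
  proof (cases "w \<in> \<phi> ` verts H")
    case True
    then have "fibre H (h \<circ> \<phi>) (h w) = fibre H \<phi> w" using h by (auto dest: inj_onD)
    then show ?thesis using g(2)[of "h w"] by simp
  next
    case False
    then have empty: "fibre H \<phi> w = {}" by auto
    show ?thesis unfolding empty by (simp add: outflow_empty)
  qed
  then show ?thesis using g(1) unfolding flow_along_def by blast
qed

lemma flow_along_inj:
  assumes H: "multigraph H" and \<phi>: "inj_on \<phi> (verts H)" and flow: "flow_along H \<phi> \<beta>"
  shows "has_nowhere_zero_flow H \<beta>"
proof -
  have "flow_along H id \<beta>"
    by (rule flow_along_comp_inj[of \<phi>]) (use \<phi> flow in simp_all)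
  moreover have "\<beta> w = (\<Sum>v\<in>fibre H id w. \<beta> v)" if "w \<in> verts H" for w
  proof -
    have "fibre H id w = {w}" using that by auto
    then show ?thesis by simp
  qed
  ultimately show ?thesis using graph_image_flow_iff[OF H graph_image_id] by blast
qed

lemma sum_fibres:
  assumes "finite (verts H)" "finite T"
  shows "(\<Sum>w\<in>T. \<Sum>v\<in>fibre H \<phi> w. f v) = (\<Sum>v\<in>{v\<in>verts H. \<phi> v \<in> T}. f v)"
proof -
  let ?S = "{v\<in>verts H. \<phi> v \<in> T}"
  have "(\<Sum>w\<in>T. sum f {v\<in>?S. \<phi> v = w}) = sum f ?S"
    by (rule sum.group) (use assms in auto)
  moreover have "{v\<in>?S. \<phi> v = w} = fibre H \<phi> w" if "w \<in> T" for w
    using that by auto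
  ultimately show ?thesis by simp
qed

lemma card_edges_le_fibres:
  assumes H: "multigraph H" and K: "graph_image \<phi> \<epsilon> H K"
  shows "card (edges H) \<le> card (edges K) + (\<Sum>w\<in>verts K. card (inner H (fibre H \<phi> w)))"
proof -
  let ?N = "{e\<in>edges H. inj_on \<phi> (ends H e)}"
  have fin: "finite (edges H)" "finite (verts K)"
    using multigraph_finite[OF H] multigraph_finite[OF graph_image_multigraph[OF H K]] by auto
  have "edges H \<subseteq> ?N \<union> (\<Union>w\<in>verts K. inner H (fibre H \<phi> w))"
  proof
    fix e assume e: "e \<in> edges H"
    obtain a b where ab: "a \<noteq> b" "a \<in> verts H" "b \<in> verts H" "ends H e = {a, b}"
      using multigraph_edgeE[OF H e] .
    show "e \<in> ?N \<union> (\<Union>w\<in>verts K. inner H (fibre H \<phi> w))"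
    proof (cases "\<phi> a = \<phi> b")
      case True
      then have "e \<in> inner H (fibre H \<phi> (\<phi> a))" using e ab by (simp add: inner_def)
      moreover have "\<phi> a \<in> verts K" using ab(2) graph_imageD(1)[OF K] by simp
      ultimately show ?thesis by blast
    next
      case False
      then show ?thesis using e ab by simp
    qed
  qed
  then have "card (edges H) \<le> card (?N \<union> (\<Union>w\<in>verts K. inner H (fibre H \<phi> w)))"
    by (rule card_mono[rotated]) (use fin finite_inner[OF H] in simp)
  also have "\<dots> \<le> card ?N + card (\<Union>w\<in>verts K. inner H (fibre H \<phi> w))" by (rule card_Un_le)
  also have "card ?N = card (edges K)" by (rule bij_betw_same_card[OF graph_imageD(2)[OF K]])
  also have "card (\<Union>w\<in>verts K. inner H (fibre H \<phi> w)) \<le> (\<Sum>w\<in>verts K. card (inner H (fibre H \<phi> w)))"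
    by (rule card_UN_le[OF fin(2)])
  finally show ?thesis by simp
qed

text \<open>Take a labelling with the fewest values among those along which there is no flow.
  Every proper quotient of its image is the image of a coarser labelling, and so has a
  flow by the choice. The fibres of the labellings compared are arbitrary vertex sets, so
  that this class is visibly closed under composition with the quotient maps of the
  image.\<close>

lemma no_flow_quotient:
  fixes H :: "('v, 'e) mgraph"
  assumes H: "multigraph H" and ne: "verts H \<noteq> {}" and zero: "(\<Sum>v\<in>verts H. \<beta> v) = 0"
    and no: "\<not> has_nowhere_zero_flow H \<beta>"
  obtains \<phi> :: "'v \<Rightarrow> nat" and \<epsilon> :: "'e \<Rightarrow> nat" and K and \<gamma>
  where "graph_image \<phi> \<epsilon> H K" "2 \<le> card (verts K)" "(\<Sum>w\<in>verts K. \<gamma> w) = 0"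
    "connected_graph K \<Longrightarrow> flow_critical K \<gamma>"
proof -
  have fin: "finite (verts H)" "finite (edges H)" using multigraph_finite[OF H] by auto
  obtain \<phi>0 :: "'v \<Rightarrow> nat" where "inj_on \<phi>0 (verts H)"
    using finite_imp_inj_to_nat_seg[OF fin(1)] by blast
  then have "\<not> flow_along H \<phi>0 \<beta>" using flow_along_inj[OF H] no by blast
  from ex_has_least_nat[of "\<lambda>\<phi>. \<not> flow_along H \<phi> \<beta>", OF this, of "\<lambda>\<phi>. card (\<phi> ` verts H)"]
  obtain \<phi> :: "'v \<Rightarrow> nat" where \<phi>: "\<not> flow_along H \<phi> \<beta>"
      and least: "\<And>\<psi> :: 'v \<Rightarrow> nat. \<not> flow_along H \<psi> \<beta> \<Longrightarrow> card (\<phi> ` verts H) \<le> card (\<psi> ` verts H)"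
    by metis
  obtain \<epsilon> :: "'e \<Rightarrow> nat" where \<epsilon>: "inj_on \<epsilon> (edges H)"
    using finite_imp_inj_to_nat_seg[OF fin(2)] by blast
  define K where "K = \<lparr>verts = \<phi> ` verts H, edges = \<epsilon> ` {e\<in>edges H. inj_on \<phi> (ends H e)},
    ends = (\<lambda>i. \<phi> ` ends H (the_inv_into (edges H) \<epsilon> i))\<rparr>"
  have K: "graph_image \<phi> \<epsilon> H K"
    unfolding graph_image_def
  proof (intro conjI ballI impI)
    show "bij_betw \<epsilon> {e\<in>edges H. inj_on \<phi> (ends H e)} (edges K)"
      unfolding bij_betw_def K_def by (simp add: inj_on_subset[OF \<epsilon>])
  qed (simp_all add: K_def the_inv_into_f_f[OF \<epsilon>])
  define \<gamma> where "\<gamma> w = (\<Sum>v\<in>fibre H \<phi> w. \<beta> v)" for w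
  have mK: "multigraph K" by (rule graph_image_multigraph[OF H K])
  have V: "verts K = \<phi> ` verts H" by (rule graph_imageD(1)[OF K])
  have zero\<gamma>: "(\<Sum>w\<in>verts K. \<gamma> w) = 0"
    unfolding \<gamma>_def using sum_fibres[OF fin(1), where T = "verts K" and \<phi> = \<phi> and f = \<beta>] V fin(1) zero
    by (simp cong: conj_cong)
  have two: "2 \<le> card (verts K)"
  proof (rule ccontr)
    \<comment> \<open>With a single label, a total boundary of zero is met by any arc values.\<close>
    assume "\<not> 2 \<le> card (verts K)"
    moreover have "card (verts K) \<noteq> 0" using V ne fin(1) by simp
    ultimately have "card (verts K) = 1" by linarith
    then obtain w0 where w0: "\<phi> ` verts H = {w0}" using V card_1_singletonE by metis
    obtain g where g: "nowhere_zero_arcs H g" using nowhere_zero_arcs_exist[OF H] .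
    have "fibre H \<phi> w = (if w = w0 then verts H else {})" for w using w0 by auto
    then have "outflow H g (fibre H \<phi> w) = (\<Sum>v\<in>fibre H \<phi> w. \<beta> v)" for w
      using outflow_verts[OF H g] zero by (simp add: outflow_empty)
    then show False using \<phi> g unfolding flow_along_def by blast
  qed
  have crit: "flow_critical K \<gamma>" if conn: "connected_graph K"
    unfolding flow_critical_def
  proof (intro conjI allI impI)
    show "\<not> has_nowhere_zero_flow K \<gamma>"
      using graph_image_flow_iff[OF H K, of \<gamma> \<beta>] \<phi> by (simp add: \<gamma>_def)
    fix Q assume "G_connected_partition K Q \<and> (\<exists>P\<in>Q. 1 < card P)"
    then obtain P where Q: "partition_on (verts K) Q" and P: "P \<in> Q" "1 < card P"
      unfolding G_connected_partition_def by blast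
    let ?\<psi> = "part_of Q \<circ> \<phi>"
    have im: "graph_image ?\<psi> \<epsilon> H (quotient_graph K Q)" by (rule quotient_graph_image[OF Q H K])
    have Qim: "Q = ?\<psi> ` verts H" using graph_imageD(1)[OF im] by (simp add: quotient_graph_def)
    then have finQ: "finite Q" using fin(1) by (metis finite_imageI)
    have "card Q < card (verts K)"
    proof -
      have PV: "P \<subseteq> verts K" using P(1) Q partition_onD1 by blast
      obtain a b where ab: "a \<in> P" "b \<in> P" "a \<noteq> b"
        using P(2) card_le_Suc0_iff_eq[of P] card_ge_0_finite[of P] by auto
      have "\<not> inj_on (part_of Q) (verts K)"
        using part_of_eq[OF Q P(1)] ab PV by (metis inj_onD subsetD)
      then have "card (part_of Q ` verts K) < card (verts K)"
        using multigraph_finite(1)[OF mK] by (metis card_image_le eq_card_imp_inj_on le_neq_implies_less)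
      moreover have "part_of Q ` verts K = Q"
        unfolding V by (rule trans[OF image_comp Qim[symmetric]])
      ultimately show ?thesis by (simp only:)
    qed
    \<comment> \<open>The parts of \<open>Q\<close> are renamed to numbers, so that minimality applies to the composed labelling.\<close>
    obtain h :: "nat set \<Rightarrow> nat" where h: "inj_on h Q"
      using finite_imp_inj_to_nat_seg[OF finQ] by blast
    have "(h \<circ> ?\<psi>) ` verts H = h ` (?\<psi> ` verts H)" by (rule image_comp[symmetric])
    then have "card ((h \<circ> ?\<psi>) ` verts H) = card Q"
      by (simp only: Qim[symmetric] card_image[OF h])
    then have "card ((h \<circ> ?\<psi>) ` verts H) < card (\<phi> ` verts H)"
      using \<open>card Q < card (verts K)\<close> by (simp only: V)
    then have "flow_along H (h \<circ> ?\<psi>) \<beta>"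
      using least[of "h \<circ> ?\<psi>"] by (meson not_le)
    then have along: "flow_along H ?\<psi> \<beta>" 
      by (rule flow_along_comp_inj[rotated]) (simp only: Qim[symmetric] h)
    show "has_nowhere_zero_flow (quotient_graph K Q) (quotient_boundary \<gamma>)"
    proof (rule iffD2[OF graph_image_flow_iff[OF H im] along])
      fix R assume "R \<in> verts (quotient_graph K Q)"
      then have R: "R \<in> Q" by (simp add: quotient_graph_def)
      have RV: "R \<subseteq> verts K" using R Q partition_onD1 by blast
      have "{v\<in>verts H. \<phi> v \<in> R} = fibre H ?\<psi> R"
      proof -
        have "\<phi> v \<in> R \<longleftrightarrow> part_of Q (\<phi> v) = R" if "v \<in> verts H" for v
          using that part_of_eq[OF Q R] part_of_mem(2)[OF Q, of "\<phi> v"] V by auto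
        then show ?thesis by auto
      qed
      then show "quotient_boundary \<gamma> R = (\<Sum>v\<in>fibre H ?\<psi> R. \<beta> v)"
        unfolding quotient_boundary_def \<gamma>_def
        using sum_fibres[OF fin(1), where T = R and \<phi> = \<phi> and f = \<beta>] finite_subset[OF RV] multigraph_finite(1)[OF mK] by simp
    qed
  qed (rule conn)
  show thesis by (rule that[OF K two zero\<gamma> crit])
qed

text \<open>Let \<open>K\<close> be a quotient without flow that has the fewest vertices. A separation of
  \<open>K\<close> pulls back to one of \<open>H\<close>, so that \<open>H\<close> has at most \<open>3|V(H)| - 6\<close> edges. If \<open>K\<close> is
  connected, then it is too small to be denser than \<open>3|V(K)| - 5\<close>; replacing a vertex of
  \<open>K\<close> by its fibre \<open>P\<close> adds \<open>|P| - 1\<close> vertices and at most \<open>3(|P| - 1)\<close> edges.\<close>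

lemma no_flow_density:
  fixes H :: "('v, 'e) mgraph"
  assumes minimal: "\<And>K :: (nat, nat) mgraph. dense_flow_critical K \<Longrightarrow> n \<le> card (verts K)"
    and H: "multigraph H" "verts H \<noteq> {}" "card (verts H) < n"
    and zero: "(\<Sum>v\<in>verts H. \<beta> v) = 0" and no: "\<not> has_nowhere_zero_flow H \<beta>"
    and sparse: "\<And>A. A \<noteq> {} \<Longrightarrow> A \<subset> verts H \<Longrightarrow> int (card (inner H A)) \<le> 3 * int (card A) - 3"
  shows "int (card (edges H)) \<le> 3 * int (card (verts H)) - 5"
proof -
  obtain \<phi> :: "'v \<Rightarrow> nat" and \<epsilon> :: "'e \<Rightarrow> nat" and K \<gamma> where K: "graph_image \<phi> \<epsilon> H K"
      and two: "2 \<le> card (verts K)" and zero\<gamma>: "(\<Sum>w\<in>verts K. \<gamma> w) = 0"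
      and crit: "connected_graph K \<Longrightarrow> flow_critical K \<gamma>"
    using no_flow_quotient[OF H(1,2) zero no] by metis
  have fin: "finite (verts H)" using multigraph_finite[OF H(1)] by simp
  have mK: "multigraph K" by (rule graph_image_multigraph[OF H(1) K])
  have V: "verts K = \<phi> ` verts H" by (rule graph_imageD(1)[OF K])
  have finK: "finite (verts K)" using V fin by simp
  show ?thesis
  proof (cases "connected_graph K")
    case False
    obtain S where S: "S \<noteq> {}" "S \<subset> verts K"
        "\<And>i. i \<in> edges K \<Longrightarrow> ends K i \<subseteq> S \<or> ends K i \<subseteq> verts K - S"
      using disconnected_separation[OF _ False mK] V H(2) by blast
    define A where "A = {v\<in>verts H. \<phi> v \<in> S}"
    have A: "A \<noteq> {}" "A \<subset> verts H" using S(1,2) V unfolding A_def by auto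
    have sep: "ends H e \<subseteq> A \<or> ends H e \<subseteq> verts H - A" if e: "e \<in> edges H" for e
    proof -
      obtain a b where ab: "a \<noteq> b" "a \<in> verts H" "b \<in> verts H" "ends H e = {a, b}"
        using multigraph_edgeE[OF H(1) e] .
      have "\<phi> a \<in> S \<longleftrightarrow> \<phi> b \<in> S"
      proof (cases "\<phi> a = \<phi> b")
        case False
        then have inj: "inj_on \<phi> (ends H e)" using ab by simp
        have "\<epsilon> e \<in> edges K" using bij_betwE[OF graph_imageD(2)[OF K]] e inj by simp
        moreover have "ends K (\<epsilon> e) = {\<phi> a, \<phi> b}" using graph_imageD(3)[OF K e inj] ab by simp
        ultimately show ?thesis using S(3)[of "\<epsilon> e"] by auto
      qed simp
      then show ?thesis using ab unfolding A_def by auto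
    qed
    have "edges H \<subseteq> inner H A \<union> inner H (verts H - A)"
      using sep unfolding inner_def by blast
    then have "card (edges H) \<le> card (inner H A \<union> inner H (verts H - A))"
      by (rule card_mono[rotated]) (simp add: finite_inner[OF H(1)])
    also have "\<dots> \<le> card (inner H A) + card (inner H (verts H - A))" by (rule card_Un_le)
    finally have le: "card (edges H) \<le> card (inner H A) + card (inner H (verts H - A))" .
    have "card (verts H) = card A + card (verts H - A)"
      using A(2) fin by (metis card_Diff_subset card_mono finite_subset le_add_diff_inverse psubset_imp_subset)
    moreover have "verts H - A \<noteq> {}" "verts H - A \<subset> verts H" using A by auto
    ultimately show ?thesis using le sparse[OF A] sparse[of "verts H - A"] by simp
  next
    case True
    have "Z3_boundary K \<gamma>"
      unfolding Z3_boundary_def connected_components[OF True] using zero\<gamma> by simp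
    then have "int (card (edges K)) \<le> 3 * int (card (verts K)) - 5"
      if "card (verts K) < n"
      using minimal[of K] that mK crit[OF True] unfolding dense_flow_critical_def by force
    moreover have "card (verts K) \<le> card (verts H)" using V card_image_le[OF fin] by simp
    ultimately have eK: "int (card (edges K)) \<le> 3 * int (card (verts K)) - 5" using H(3) by simp
    have "int (card (inner H (fibre H \<phi> w))) \<le> 3 * int (card (fibre H \<phi> w)) - 3"
      if w: "w \<in> verts K" for w
    proof (rule sparse)
      show "fibre H \<phi> w \<noteq> {}" using w V by auto
      have "verts K \<noteq> {w}" using two by auto
      then obtain w' where "w' \<in> verts K" "w' \<noteq> w" using w by blast
      then show "fibre H \<phi> w \<subset> verts H" using V by auto
    qed
    then have "(\<Sum>w\<in>verts K. int (card (inner H (fibre H \<phi> w))))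
        \<le> (\<Sum>w\<in>verts K. 3 * int (card (fibre H \<phi> w)) - 3)"
      by (rule sum_mono)
    also have "\<dots> = 3 * (\<Sum>w\<in>verts K. int (card (fibre H \<phi> w))) - 3 * int (card (verts K))"
      by (simp add: sum_subtractf sum_distrib_left)
    also have "(\<Sum>w\<in>verts K. int (card (fibre H \<phi> w))) = int (card (verts H))"
      using sum_fibres[OF fin finK, where \<phi> = \<phi> and f = "\<lambda>_. 1 :: int"] V by (simp cong: conj_cong)
    finally show ?thesis
      using eK card_edges_le_fibres[OF H(1) K]
      by (simp flip: of_nat_sum)
  qed
qed

section \<open>Contractions and cuts\<close>

lemma connected_singleton: "connected_graph (induced_subgraph G {v})"
  unfolding connected_graph_def induced_subgraph_def by simp

text \<open>The contraction of \<open>A\<close> has a nowhere-zero flow. Seen in \<open>G\<close>, it is correct at all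
  vertices outside \<open>A\<close>, so the lack of a flow in \<open>G\<close> must be due to \<open>G[A]\<close>.\<close>

lemma flow_critical_no_flow_inside:
  assumes G: "multigraph G" and crit: "flow_critical G \<beta>" and zero: "(\<Sum>v\<in>verts G. \<beta> v) = 0"
    and A: "A \<subseteq> verts G" "1 < card A" "connected_graph (induced_subgraph G A)"
  obtains \<beta>' where "(\<Sum>v\<in>A. \<beta>' v) = 0" "\<not> has_nowhere_zero_flow (induced_subgraph G A) \<beta>'"
proof -
  define \<P> where "\<P> = insert A ((\<lambda>v. {v}) ` (verts G - A))"
  have part: "partition_on (verts G) \<P>"
  proof (rule partition_onI)
    show "\<Union>\<P> = verts G" using A(1) unfolding \<P>_def by auto
    show "disjnt P Q" if "P \<in> \<P>" "Q \<in> \<P>" "P \<noteq> Q" for P Q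
      using that unfolding \<P>_def disjnt_def by auto
    show "{} \<notin> \<P>" using A(2) unfolding \<P>_def by auto
  qed
  have "G_connected_partition G \<P>"
    unfolding G_connected_partition_def using part A(3) connected_singleton
    by (auto simp: \<P>_def)
  then have flow: "has_nowhere_zero_flow (quotient_graph G \<P>) (quotient_boundary \<beta>)"
    using crit A(2) unfolding flow_critical_def \<P>_def by blast
  have im: "graph_image (part_of \<P>) id G (quotient_graph G \<P>)"
    using quotient_graph_image[OF part G graph_image_id] by simp
  have "quotient_boundary \<beta> P = (\<Sum>v\<in>fibre G (part_of \<P>) P. \<beta> v)"
    if "P \<in> verts (quotient_graph G \<P>)" for P
    using that fibre_part_of[OF part, of P] by (simp add: quotient_graph_def quotient_boundary_def)
  then have "flow_along G (part_of \<P>) \<beta>" using graph_image_flow_iff[OF G im] flow by blast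
  then obtain g where g: "nowhere_zero_arcs G g"
      "\<And>P. outflow G g (fibre G (part_of \<P>) P) = (\<Sum>v\<in>fibre G (part_of \<P>) P. \<beta> v)"
    unfolding flow_along_def by blast
  have off: "outflow G g {u} = \<beta> u" if "u \<in> verts G - A" for u
  proof -
    have "{u} \<in> \<P>" using that unfolding \<P>_def by blast
    then show ?thesis using g(2)[of "{u}"] fibre_part_of[OF part, of "{u}"] by simp
  qed
  have "\<not> has_nowhere_zero_flow G \<beta>" using crit unfolding flow_critical_def by blast
  then show thesis using no_flow_inside[OF G A(1) g(1) off zero] that by blast
qed

lemma inner_induced: "B \<subseteq> A \<Longrightarrow> inner (induced_subgraph G A) B = inner G B"
  unfolding inner_def induced_subgraph_def by auto

definition cut :: "('v, 'e) mgraph \<Rightarrow> 'v set \<Rightarrow> 'e set" where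
  "cut G A = {e\<in>edges G. ends G e \<inter> A \<noteq> {} \<and> ends G e \<inter> (verts G - A) \<noteq> {}}"

lemma cut_complement: "A \<subseteq> verts G \<Longrightarrow> cut G (verts G - A) = cut G A"
  unfolding cut_def by (auto simp: double_diff)

lemma cut_singleton:
  assumes G: "multigraph G"
  shows "cut G {v} = incident_edges G v"
proof -
  have "ends G e \<inter> (verts G - {v}) \<noteq> {}" if e: "e \<in> edges G" for e
    by (rule multigraph_edgeE[OF G e]) auto
  then show ?thesis unfolding cut_def incident_edges_def by auto
qed

lemma card_edges_cut:
  assumes G: "multigraph G" and A: "A \<subseteq> verts G"
  shows "card (edges G) = card (inner G A) + card (inner G (verts G - A)) + card (cut G A)"
proof -
  have nonempty: "ends G e \<noteq> {}" "ends G e \<subseteq> verts G" if e: "e \<in> edges G" for e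
    using multigraph_edgeE[OF G e, of "ends G e \<noteq> {}"] ends_verts[OF G e] by auto
  have "edges G = (inner G A \<union> inner G (verts G - A)) \<union> cut G A"
    using nonempty(2) unfolding inner_def cut_def by blast
  moreover have "inner G A \<inter> inner G (verts G - A) = {}"
    using nonempty(1) unfolding inner_def by blast
  moreover have "(inner G A \<union> inner G (verts G - A)) \<inter> cut G A = {}"
    unfolding inner_def cut_def by blast
  moreover have "finite (cut G A)" using multigraph_finite[OF G] unfolding cut_def by simp
  ultimately show ?thesis using finite_inner[OF G] by (metis card_Un_disjoint finite_Un)
qed

section \<open>The minimal dense flow-critical graph\<close>

text \<open>As \<open>G\<close> is connected, a boundary for \<open>G\<close> is a function of total zero.\<close>

locale minimal_dense_graph =
  fixes G :: "('v, 'e) mgraph" and \<beta> :: "'v \<Rightarrow> 3"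
  assumes G: "multigraph G"
    and crit: "flow_critical G \<beta>"
    and zero: "(\<Sum>v\<in>verts G. \<beta> v) = 0"
    and dense: "3 * int (card (verts G)) - 4 \<le> int (card (edges G))"
    and minimal: "\<And>K :: (nat, nat) mgraph. dense_flow_critical K \<Longrightarrow> card (verts G) \<le> card (verts K)"
begin

lemma fin: "finite (verts G)" "finite (edges G)"
  using multigraph_finite[OF G] by auto

lemma no_flow: "\<not> has_nowhere_zero_flow G \<beta>"
  using crit unfolding flow_critical_def by blast

text \<open>Induction on \<open>A\<close>. The weak bound \<open>3|A| - 3\<close> is the hypothesis of the density
  estimate, and a single vertex attains it; the strong bound \<open>3|A| - 5\<close> is the conclusion.
  If \<open>G[A]\<close> is disconnected, then \<open>A\<close> cannot be contracted, but the weak bounds for two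
  separated pieces suffice.\<close>

lemma inner_sparse:
  assumes "A \<noteq> {}" "A \<subset> verts G"
  shows "int (card (inner G A)) \<le> 3 * int (card A) - 3"
    and "2 \<le> card A \<Longrightarrow> int (card (inner G A)) \<le> 3 * int (card A) - 5"
proof -
  have "finite A" using assms(2) fin(1) finite_subset by blast
  then have "int (card (inner G A)) \<le> 3 * int (card A) - 3 \<and>
      (2 \<le> card A \<longrightarrow> int (card (inner G A)) \<le> 3 * int (card A) - 5)"
    using assms
  proof (induction A rule: finite_psubset_induct)
    case (psubset A)
    note A = \<open>A \<noteq> {}\<close> \<open>A \<subset> verts G\<close> \<open>finite A\<close>
    have IH: "int (card (inner G B)) \<le> 3 * int (card B) - 3" if "B \<noteq> {}" "B \<subset> A" for B
      using psubset.IH[OF that(2,1)] that A by blast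
    show ?case
    proof (cases "2 \<le> card A")
      case False
      moreover have "card A \<noteq> 0" using A by simp
      ultimately have "card A = 1" by linarith
      then obtain v where v: "A = {v}" by (rule card_1_singletonE)
      show ?thesis unfolding v inner_singleton[OF G] by simp
    next
      case True
      let ?H = "induced_subgraph G A"
      have H: "multigraph ?H" by (rule multigraph_induced[OF G]) (use A in blast)
      have V: "verts ?H = A" and E: "edges ?H = inner G A"
        by (simp_all add: induced_subgraph_def inner_def)
      have inH: "inner ?H B = inner G B" if "B \<subseteq> A" for B by (rule inner_induced[OF that])
      have "int (card (inner G A)) \<le> 3 * int (card A) - 5"
      proof (cases "connected_graph ?H")
        case conn: True
        obtain \<beta>' where \<beta>': "(\<Sum>v\<in>A. \<beta>' v) = 0" "\<not> has_nowhere_zero_flow ?H \<beta>'"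
          by (rule flow_critical_no_flow_inside[OF G crit zero _ _ conn]) (use A True in auto)
        have "int (card (edges ?H)) \<le> 3 * int (card (verts ?H)) - 5"
        proof (rule no_flow_density[OF minimal H _ _ _ \<beta>'(2)])
          show "int (card (inner ?H B)) \<le> 3 * int (card B) - 3" if "B \<noteq> {}" "B \<subset> verts ?H" for B
            using IH[of B] inH[of B] that V by auto
          show "card (verts ?H) < card (verts G)" unfolding V by (rule psubset_card_mono[OF fin(1) A(2)])
        qed (use V A \<beta>'(1) in simp_all)
        then show ?thesis unfolding V E .
      next
        case False
        have "verts ?H \<noteq> {}" using V A by simp
        then obtain S where S': "S \<noteq> {}" "S \<subset> verts ?H"
            "\<And>e. e \<in> edges ?H \<Longrightarrow> ends ?H e \<subseteq> S \<or> ends ?H e \<subseteq> verts ?H - S"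
          using disconnected_separation[OF _ False H] by metis
        then have S: "S \<noteq> {}" "S \<subset> A" and
            "\<And>e. e \<in> inner G A \<Longrightarrow> ends ?H e \<subseteq> S \<or> ends ?H e \<subseteq> A - S"
          unfolding V E by blast+
        then have sep: "\<And>e. e \<in> inner G A \<Longrightarrow> ends G e \<subseteq> S \<or> ends G e \<subseteq> A - S"
          by (simp add: induced_subgraph_def)
        have "inner G A \<subseteq> inner G S \<union> inner G (A - S)"
          using sep unfolding inner_def by blast
        then have "card (inner G A) \<le> card (inner G S \<union> inner G (A - S))"
          by (rule card_mono[rotated]) (simp add: finite_inner[OF G])
        also have "\<dots> \<le> card (inner G S) + card (inner G (A - S))" by (rule card_Un_le)
        finally have "card (inner G A) \<le> card (inner G S) + card (inner G (A - S))" .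
        moreover have "card A = card S + card (A - S)"
          using S(2) A(3) by (metis card_Diff_subset card_mono finite_subset le_add_diff_inverse psubset_imp_subset)
        ultimately show ?thesis using IH[OF S(1,2)] IH[of "A - S"] S(1,2) by force
      qed
      then show ?thesis by simp
    qed
  qed
  then show "int (card (inner G A)) \<le> 3 * int (card A) - 3"
    and "2 \<le> card A \<Longrightarrow> int (card (inner G A)) \<le> 3 * int (card A) - 5" by auto
qed

lemma three_vertices: "3 \<le> card (verts G)"
proof (rule ccontr)
  assume less: "\<not> 3 \<le> card (verts G)"
  have "verts G \<noteq> {}" using crit unfolding flow_critical_def connected_graph_def by blast
  then have "card (verts G) \<noteq> 0" using fin by simp
  with less consider "card (verts G) = 1" | "card (verts G) = 2" by linarith
  then show False
  proof cases
    case 1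
    then obtain v where v: "verts G = {v}" by (rule card_1_singletonE)
    obtain g where g: "nowhere_zero_arcs G g" using nowhere_zero_arcs_exist[OF G] .
    then have "outflow G g {v} = \<beta> v" using outflow_verts[OF G g] zero v by simp
    then show False
      using no_flow g v unfolding has_nowhere_zero_flow_iff_outflow[OF G] by auto
  next
    case 2
    then obtain x y where xy: "verts G = {x, y}" "x \<noteq> y" by (auto simp: card_2_iff)
    have "2 \<le> card (edges G)" using dense 2 by simp
    then obtain T where "T \<subseteq> edges G" "card T = 2" using obtain_subset_with_card_n by blast
    then obtain e f where "e \<in> edges G" "f \<in> edges G" "e \<noteq> f" by (auto simp: card_2_iff)
    then show False using two_parallel_edges_flow[OF G xy, of e f \<beta>] no_flow zero xy by simp
  qed
qed

text \<open>The bound \<open>3|A| - 5\<close> equals \<open>1\<close> for two vertices.\<close>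

lemma no_parallel_edges:
  assumes "e \<in> edges G" "f \<in> edges G" "ends G e = ends G f"
  shows "e = f"
proof (rule ccontr)
  assume ef: "e \<noteq> f"
  obtain x y where xy: "x \<noteq> y" "x \<in> verts G" "y \<in> verts G" "ends G e = {x, y}"
    using multigraph_edgeE[OF G assms(1)] .
  have "card {x, y} = 2" using xy(1) by simp
  then have "{x, y} \<noteq> verts G" using three_vertices by force
  then have "{x, y} \<subset> verts G" using xy by blast
  then have "int (card (inner G {x, y})) \<le> 1" using inner_sparse(2)[of "{x, y}"] xy(1) by simp
  moreover have "{e, f} \<subseteq> inner G {x, y}" using assms xy(4) unfolding inner_def by simp
  then have "card {e, f} \<le> card (inner G {x, y})" by (rule card_mono[OF finite_inner[OF G]])
  ultimately show False using ef by simp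
qed

text \<open>Split off the edges \<open>p\<close> and \<open>q\<close> at \<open>v\<close>, let \<open>r\<close> and \<open>s\<close> satisfy the demand of \<open>v\<close>,
  and delete \<open>v\<close>. The graph left has \<open>n - 1\<close> vertices, at least \<open>3n - 7\<close> edges, and no
  flow for the residual boundary. It contains only one new edge, which the slack between
  \<open>3|B| - 5\<close> and \<open>3|B| - 3\<close> absorbs.\<close>

lemma no_degree_four:
  assumes v: "v \<in> verts G" and deg: "card (incident_edges G v) = 4"
  shows False
proof -
  have finI: "finite (incident_edges G v)" using fin unfolding incident_edges_def by simp
  obtain T where T: "T \<subseteq> incident_edges G v" "card T = 2"
    by (rule obtain_subset_with_card_n[of 2 "incident_edges G v"]) (simp add: deg)
  have "card (incident_edges G v - T) = 2"
    using T deg by (simp add: card_Diff_subset finite_subset[OF T(1) finI])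
  with T obtain p q r s where pq: "T = {p, q}" "p \<noteq> q" and rs: "incident_edges G v - T = {r, s}" "r \<noteq> s"
    by (auto simp: card_2_iff)
  have I: "incident_edges G v = {p, q, r, s}" using T(1) pq rs by blast
  have E: "p \<in> edges G" "q \<in> edges G" "r \<in> edges G" "s \<in> edges G"
    using I unfolding incident_edges_def by auto
  have diff: "r \<noteq> p" "r \<noteq> q" "s \<noteq> p" "s \<noteq> q" using pq rs by auto
  have other: "\<exists>w. w \<noteq> v \<and> w \<in> verts G \<and> ends G e = {v, w}" if "e \<in> incident_edges G v" for e
  proof -
    have e: "e \<in> edges G" "v \<in> ends G e" using that unfolding incident_edges_def by auto
    show ?thesis by (rule multigraph_edgeE[OF G e(1)]) (use e(2) in auto)
  qed
  obtain x where x: "x \<noteq> v" "x \<in> verts G" "ends G p = {v, x}" using other[of p] I by auto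
  obtain y where y: "y \<noteq> v" "y \<in> verts G" "ends G q = {v, y}" using other[of q] I by auto
  obtain a where a: "a \<noteq> v" "a \<in> verts G" "ends G r = {v, a}" using other[of r] I by auto
  obtain b where b: "b \<noteq> v" "b \<in> verts G" "ends G s = {v, b}" using other[of s] I by auto
  have xy: "x \<noteq> y" using no_parallel_edges[OF E(1,2)] x y pq(2) by auto
  let ?L = "lift G p q x y"
  have L: "multigraph ?L" by (rule multigraph_lift[OF G x(2) y(2) xy])
  have VL: "verts ?L = verts G" and EL: "edges ?L = edges G - {q}" by (simp_all add: lift_def)
  have ends_p: "ends ?L p = {x, y}" and ends_L: "\<And>e. e \<noteq> p \<Longrightarrow> ends ?L e = ends G e"
    by (simp_all add: lift_def)
  have noL: "\<not> has_nowhere_zero_flow ?L \<beta>"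
    using lift_flow[OF G E(1,2) pq(2) x(3) y(3) xy] no_flow by blast
  obtain c d where cd: "c \<noteq> 0" "d \<noteq> 0" "c + d = \<beta> v" using Z3_sum_of_two_nonzero by blast
  obtain g0 where g0: "nowhere_zero_arcs ?L g0" using nowhere_zero_arcs_exist[OF L] .
  define g where "g i u = (if i = r then if u = v then c else - c
    else if i = s then if u = v then d else - d else g0 i u)" for i u
  have g: "nowhere_zero_arcs ?L g"
    unfolding nowhere_zero_arcs_def
  proof (intro ballI)
    fix i assume i: "i \<in> edges ?L"
    show "(\<Sum>u\<in>ends ?L i. g i u) = 0 \<and> (\<forall>u\<in>ends ?L i. g i u \<noteq> 0)"
    proof (cases "i = r \<or> i = s")
      case True
      then show ?thesis using ends_L diff a b cd rs(2) by (auto simp: g_def)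
    next
      case False
      then show ?thesis using g0 i unfolding nowhere_zero_arcs_def by (simp add: g_def)
    qed
  qed
  have at_v: "v \<in> ends ?L e \<longleftrightarrow> e \<in> {r, s}" if e: "e \<in> edges ?L" for e
  proof (cases "e = p")
    case True
    then show ?thesis using ends_p x(1) y(1) diff by simp
  next
    case False
    then have "v \<in> ends ?L e \<longleftrightarrow> e \<in> incident_edges G v"
      using e ends_L EL unfolding incident_edges_def by simp
    then show ?thesis using I False e EL by auto
  qed
  have out_v: "outflow ?L g {v} = \<beta> v"
  proof -
    have "outflow ?L g {v} = (\<Sum>e\<in>{r, s}. g e v)"
      unfolding outflow_singleton
    proof (rule sum.mono_neutral_cong_right)
      show "finite (edges ?L)" using multigraph_finite[OF L] by simp
      show "{r, s} \<subseteq> edges ?L" using EL E diff by simp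
    qed (use at_v EL E diff in auto)
    also have "\<dots> = \<beta> v" using rs(2) cd(3) by (simp add: g_def)
    finally show ?thesis .
  qed
  define A where "A = verts G - {v}"
  have A: "A \<subseteq> verts ?L" using VL unfolding A_def by blast
  let ?H = "induced_subgraph ?L A"
  obtain \<beta>' where \<beta>': "(\<Sum>u\<in>A. \<beta>' u) = 0" "\<not> has_nowhere_zero_flow ?H \<beta>'"
  proof (rule no_flow_inside[OF L A g _ _ noL])
    show "outflow ?L g {u} = \<beta> u" if "u \<in> verts ?L - A" for u
      using that out_v VL unfolding A_def by auto
  qed (use zero VL that in auto)
  have cardA: "card A = card (verts G) - 1" using v fin unfolding A_def by simp
  have VH: "verts ?H = A" by (simp add: induced_subgraph_def)
  have "edges G - {q, r, s} \<subseteq> edges ?H"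
  proof
    fix e assume e: "e \<in> edges G - {q, r, s}"
    then have eL: "e \<in> edges ?L" using EL by simp
    then have "ends ?L e \<subseteq> A" using at_v[OF eL] e ends_verts[OF L eL] VL unfolding A_def by auto
    then show "e \<in> edges ?H" using eL by (simp add: induced_subgraph_def)
  qed
  then have "card (edges G - {q, r, s}) \<le> card (edges ?H)"
    by (rule card_mono[rotated]) (rule multigraph_finite(2)[OF multigraph_induced[OF L A]])
  moreover have "card (edges G - {q, r, s}) = card (edges G) - 3"
    using E diff rs(2) fin by (subst card_Diff_subset) auto
  moreover have "int (card (edges ?H)) \<le> 3 * int (card (verts ?H)) - 5"
  proof (rule no_flow_density[OF minimal multigraph_induced[OF L A] _ _ _ \<beta>'(2)])
    show "verts ?H \<noteq> {}" "card (verts ?H) < card (verts G)"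
      using VH cardA three_vertices by auto
    show "(\<Sum>v\<in>verts ?H. \<beta>' v) = 0" using VH \<beta>'(1) by simp
    fix B assume B: "B \<noteq> {}" "B \<subset> verts ?H"
    have BV: "B \<subset> verts G" "finite B" using B VH fin finite_subset unfolding A_def by auto
    have inB: "inner ?H B = inner ?L B" by (rule inner_induced) (use B VH in blast)
    show "int (card (inner ?H B)) \<le> 3 * int (card B) - 3"
    proof (cases "2 \<le> card B")
      case True
      have "inner ?L B \<subseteq> insert p (inner G B)"
        using ends_L EL unfolding inner_def by auto
      then have "card (inner ?L B) \<le> card (insert p (inner G B))"
        by (rule card_mono[rotated]) (simp add: finite_inner[OF G])
      also have "\<dots> \<le> card (inner G B) + 1"
        by (simp add: card_insert_if finite_inner[OF G])
      finally show ?thesis using inner_sparse(2)[OF B(1) BV(1) True] inB by simp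
    next
      case False
      moreover have "card B \<noteq> 0" using B(1) BV(2) by simp
      ultimately have "card B = 1" by linarith
      then obtain w where w: "B = {w}" by (rule card_1_singletonE)
      then show ?thesis unfolding w inner_singleton[OF multigraph_induced[OF L A]] by simp
    qed
  qed
  ultimately show False using dense cardA three_vertices unfolding VH by linarith
qed

text \<open>Split off \<open>p = zx\<close> and \<open>q = zy\<close>; the new edge is parallel to \<open>e = xy\<close>, and \<open>y\<close> is
  merged into \<open>x\<close>. A set \<open>B\<close> containing the merged vertex stands for the set \<open>insert y B\<close>
  in \<open>G\<close>: this has one vertex more, which costs \<open>3\<close> in the bound \<open>3|B| - 5\<close>, but it spans
  the edge \<open>e\<close>, which has disappeared. So \<open>3(|B| + 1) - 5 - 1 = 3|B| - 3\<close> is just enough.\<close>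

lemma no_triangle:
  assumes e: "e \<in> edges G" "ends G e = {x, y}"
    and p: "p \<in> edges G" "ends G p = {z, x}" and q: "q \<in> edges G" "ends G q = {z, y}"
    and distinct: "x \<noteq> y" "y \<noteq> z" "x \<noteq> z"
  shows False
proof -
  have V: "x \<in> verts G" "y \<in> verts G" using ends_verts[OF G e(1)] e(2) by auto
  have diff: "e \<noteq> p" "e \<noteq> q" "p \<noteq> q" using e(2) p(2) q(2) distinct by (auto simp: doubleton_eq_iff)
  let ?L = "lift G p q x y" and ?\<phi> = "\<lambda>v. if v = y then x else v"
  have L: "multigraph ?L" by (rule multigraph_lift[OF G V distinct(1)])
  have VL: "verts ?L = verts G" and EL: "edges ?L = edges G - {q}" by (simp_all add: lift_def)
  have ends_p: "ends ?L p = {x, y}" and ends_L: "\<And>i. i \<noteq> p \<Longrightarrow> ends ?L i = ends G i"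
    by (simp_all add: lift_def)
  have noL: "\<not> has_nowhere_zero_flow ?L \<beta>"
    using lift_flow[OF G p(1) q(1) diff(3) p(2) q(2) distinct(1)] no_flow by blast
  have no_along: "\<not> flow_along ?L ?\<phi> \<beta>"
  proof
    assume "flow_along ?L ?\<phi> \<beta>"
    then have "has_nowhere_zero_flow ?L \<beta>"
      by (rule merge_parallel_flow[OF L _ _ diff(1) _ ends_p, rotated -1])
        (use EL VL e p diff ends_L zero in simp_all)
    then show False using noL by blast
  qed
  define K where "K = \<lparr>verts = ?\<phi> ` verts ?L, edges = {i\<in>edges ?L. inj_on ?\<phi> (ends ?L i)},
    ends = (\<lambda>i. ?\<phi> ` ends ?L i)\<rparr>"
  have K: "graph_image ?\<phi> id ?L K" unfolding graph_image_def K_def by (simp add: bij_betw_def)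
  have mK: "multigraph K" by (rule graph_image_multigraph[OF L K])
  have VK: "verts K = verts G - {y}" using V distinct(1) VL by (auto simp: K_def)
  have cardK: "card (verts K) = card (verts G) - 1" using VK V(2) fin by simp
  define \<gamma> where "\<gamma> w = (\<Sum>v\<in>fibre ?L ?\<phi> w. \<beta> v)" for w
  have noK: "\<not> has_nowhere_zero_flow K \<gamma>"
    using graph_image_flow_iff[OF L K, of \<gamma> \<beta>] no_along by (simp add: \<gamma>_def)
  have zeroK: "(\<Sum>w\<in>verts K. \<gamma> w) = 0"
  proof -
    have "{v\<in>verts ?L. ?\<phi> v \<in> verts K} = verts G" using VK V VL distinct(1) by auto
    then show ?thesis
      unfolding \<gamma>_def using sum_fibres[of ?L "verts K", where \<phi> = ?\<phi> and f = \<beta>]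
        fin VL VK zero by simp
  qed
  have not_pq: "i \<noteq> p" "i \<noteq> q" "i \<noteq> e" if "i \<in> edges K" for i
  proof -
    have i: "i \<in> edges ?L" "inj_on ?\<phi> (ends ?L i)" using that by (simp_all add: K_def)
    then have "ends ?L i \<noteq> {x, y}" using distinct(1) by auto
    then show "i \<noteq> p" "i \<noteq> q" "i \<noteq> e" using ends_p i(1) EL ends_L[of e] diff(1) e(2) by auto
  qed
  have "edges G - {e, p, q} \<subseteq> edges K"
  proof
    fix i assume i: "i \<in> edges G - {e, p, q}"
    obtain a b where ab: "a \<noteq> b" "ends G i = {a, b}" using multigraph_edgeE[OF G, of i] i by blast
    have "ends G i \<noteq> {x, y}" using no_parallel_edges[of i e] i e by auto
    then have "inj_on ?\<phi> {a, b}" using ab by auto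
    then show "i \<in> edges K" using i ab ends_L[of i] EL by (simp add: K_def)
  qed
  then have "card (edges G - {e, p, q}) \<le> card (edges K)"
    by (rule card_mono[rotated]) (rule multigraph_finite(2)[OF mK])
  moreover have "card (edges G - {e, p, q}) = card (edges G) - 3"
    using e(1) p(1) q(1) diff fin by (subst card_Diff_subset) auto
  moreover have "int (card (edges K)) \<le> 3 * int (card (verts K)) - 5"
  proof (rule no_flow_density[OF minimal mK _ _ zeroK noK])
    show "verts K \<noteq> {}" "card (verts K) < card (verts G)" using cardK three_vertices by auto
    fix B assume B: "B \<noteq> {}" "B \<subset> verts K"
    have BV: "B \<subset> verts G" "y \<notin> B" "finite B" using B VK fin finite_subset by auto
    have in_K: "i \<in> edges G \<and> ends G i \<subseteq> {v. ?\<phi> v \<in> B}" if "i \<in> inner K B" for i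
    proof -
      have "i \<in> edges K" "?\<phi> ` ends ?L i \<subseteq> B" using that by (simp_all add: inner_def K_def)
      moreover have "ends ?L i = ends G i" using ends_L not_pq(1)[OF calculation(1)] by simp
      moreover have "i \<in> edges G" using calculation(1) EL by (simp add: K_def)
      ultimately show ?thesis by auto
    qed
    show "int (card (inner K B)) \<le> 3 * int (card B) - 3"
    proof (cases "x \<in> B")
      case False
      have "inner K B \<subseteq> inner G B"
      proof
        fix i assume "i \<in> inner K B"
        then have i: "i \<in> edges G" "ends G i \<subseteq> {v. ?\<phi> v \<in> B}" using in_K by blast+
        have "{v. ?\<phi> v \<in> B} \<subseteq> B" using False by auto
        then show "i \<in> inner G B" using i unfolding inner_def by blast
      qed
      then have "card (inner K B) \<le> card (inner G B)" by (rule card_mono[OF finite_inner[OF G]])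
      then show ?thesis using inner_sparse(1)[OF B(1) BV(1)] by simp
    next
      case True
      let ?B = "insert y B"
      have "?B \<subset> verts G" using B(2) VK V(2) by blast
      moreover have cardB: "card ?B = card B + 1" using BV by simp
      moreover have "card B \<noteq> 0" using B(1) BV(3) by simp
      ultimately have le: "int (card (inner G ?B)) \<le> 3 * int (card B) - 2"
        using inner_sparse(2)[of ?B] by simp
      have "inner K B \<subseteq> inner G ?B - {e}"
      proof
        fix i assume iK: "i \<in> inner K B"
        then have i: "i \<in> edges G" "ends G i \<subseteq> {v. ?\<phi> v \<in> B}" using in_K by blast+
        have "{v. ?\<phi> v \<in> B} \<subseteq> ?B" by auto
        moreover have "i \<noteq> e" by (rule not_pq(3)) (use iK in \<open>simp add: inner_def\<close>)
        ultimately show "i \<in> inner G ?B - {e}" using i unfolding inner_def by blast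
      qed
      then have "card (inner K B) \<le> card (inner G ?B - {e})"
        by (rule card_mono[rotated]) (simp add: finite_inner[OF G])
      also have "\<dots> < card (inner G ?B)"
        by (rule card_Diff1_less[OF finite_inner[OF G]]) (use e True in \<open>simp add: inner_def\<close>)
      finally show ?thesis using le by simp
    qed
  qed
  ultimately show False using dense cardK three_vertices by linarith
qed

text \<open>The edges inside the two sides number at most \<open>3n - 10\<close> if both sides have at
  least two vertices, and at most \<open>3n - 8\<close> if one side is a single vertex. Since \<open>G\<close> has
  at least \<open>3n - 4\<close> edges, the cut has at least \<open>6\<close> edges in the first case and at least
  \<open>4\<close> in the second, where equality would mean a vertex of degree four.\<close>

lemma cut_bound:
  assumes A: "A \<noteq> {}" "A \<subset> verts G"
  shows "5 \<le> card (cut G A)"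
    and "card (cut G A) = 5 \<Longrightarrow> \<exists>v\<in>verts G. cut G A = incident_edges G v"
proof -
  let ?A = "verts G - A"
  have A': "?A \<noteq> {}" "?A \<subset> verts G" using A by auto
  have finA: "finite A" "finite ?A" using fin A(2) finite_subset by auto
  have pos: "card A \<noteq> 0" "card ?A \<noteq> 0" using A(1) A'(1) finA by simp_all
  have V: "card (verts G) = card A + card ?A"
    using A(2) fin(1) by (metis card_Diff_subset card_mono finA(1) le_add_diff_inverse psubset_imp_subset)
  have E: "card (edges G) = card (inner G A) + card (inner G ?A) + card (cut G A)"
    by (rule card_edges_cut[OF G]) (use A in blast)
  have "5 \<le> card (cut G A) \<and> (card (cut G A) = 5 \<longrightarrow> (\<exists>v\<in>verts G. cut G A = incident_edges G v))"
  proof (cases "2 \<le> card A \<and> 2 \<le> card ?A")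
    case True
    then have "6 \<le> card (cut G A)"
      using inner_sparse(2)[OF A] inner_sparse(2)[OF A'] E V dense by linarith
    then show ?thesis by simp
  next
    case False
    have "4 \<le> card (cut G A)"
    proof (cases "2 \<le> card A")
      case True
      then show ?thesis using inner_sparse(2)[OF A] inner_sparse(1)[OF A'] E V dense by linarith
    next
      case False
      then have "2 \<le> card ?A" using V three_vertices by linarith
      then show ?thesis using inner_sparse(1)[OF A] inner_sparse(2)[OF A'] E V dense by linarith
    qed
    moreover obtain v where v: "v \<in> verts G" "cut G A = incident_edges G v"
    proof (cases "card A = 1")
      case True
      then obtain v where "A = {v}" by (rule card_1_singletonE)
      then show thesis using that[of v] cut_singleton[OF G] A(2) by auto
    next
      case not_one: False
      then have "card ?A = 1" using False pos by linarith
      then obtain v where "?A = {v}" by (rule card_1_singletonE)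
      then show thesis using that[of v] cut_singleton[OF G, of v] cut_complement[of A G] A(2) by auto
    qed
    moreover have "card (cut G A) \<noteq> 4" using no_degree_four v by metis
    ultimately show ?thesis by force
  qed
  then show "5 \<le> card (cut G A)"
    and "card (cut G A) = 5 \<Longrightarrow> \<exists>v\<in>verts G. cut G A = incident_edges G v" by auto
qed

lemma edge_connected_5: "edge_connected 5 G"
  unfolding edge_connected_def
proof (intro conjI allI impI)
  show "2 \<le> card (verts G)" using three_vertices by simp
  fix F assume F: "F \<subseteq> edges G" "card F < 5"
  show "connected_graph (delete_edges G F)"
  proof (rule ccontr)
    assume disc: "\<not> connected_graph (delete_edges G F)"
    have D: "multigraph (delete_edges G F)"
      using G unfolding multigraph_def delete_edges_def by simp
    have "verts (delete_edges G F) \<noteq> {}" using three_vertices by (auto simp: delete_edges_def)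
    then obtain S where S: "S \<noteq> {}" "S \<subset> verts (delete_edges G F)"
        "\<And>e. e \<in> edges (delete_edges G F) \<Longrightarrow>
          ends (delete_edges G F) e \<subseteq> S \<or> ends (delete_edges G F) e \<subseteq> verts (delete_edges G F) - S"
      using disconnected_separation[OF _ disc D] by metis
    have "cut G S \<subseteq> F"
      using S(3) unfolding cut_def delete_edges_def by auto
    then have "card (cut G S) \<le> card F"
      by (rule card_mono[rotated]) (rule finite_subset[OF F(1) fin(2)])
    moreover have "S \<subset> verts G" using S(2) by (simp add: delete_edges_def)
    ultimately show False using cut_bound(1)[OF S(1)] F(2) by fastforce
  qed
qed

lemma triangle_free_graph: "triangle_free G"
  unfolding triangle_free_def
proof
  assume "\<exists>u v w. u \<noteq> v \<and> v \<noteq> w \<and> u \<noteq> w \<and> adjacent G u v \<and> adjacent G v w \<and> adjacent G u w"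
  then obtain u v w where uvw: "u \<noteq> v" "v \<noteq> w" "u \<noteq> w"
      and adj: "adjacent G u v" "adjacent G v w" "adjacent G u w" by blast
  obtain e where "e \<in> edges G" "ends G e = {u, v}" using adj(1) unfolding adjacent_def by blast
  moreover obtain p where "p \<in> edges G" "ends G p = {w, u}"
    using adj(3) unfolding adjacent_def by (auto simp: insert_commute)
  moreover obtain q where "q \<in> edges G" "ends G q = {w, v}"
    using adj(2) unfolding adjacent_def by (auto simp: insert_commute)
  ultimately show False using no_triangle[of e u v p w q] uvw by blast
qed

end

theorem theorem1p9:
  fixes G :: "('v, 'e) mgraph"
  assumes "dense_flow_critical G"
    and "\<And>H :: (nat, nat) mgraph. dense_flow_critical H \<Longrightarrow> card (verts G) \<le> card (verts H)"
  shows "triangle_free G \<and> edge_connected 5 G \<and>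
    (\<forall>C. edge_cut G C \<and> card C = 5 \<longrightarrow> (\<exists>v\<in>verts G. C = incident_edges G v))"
proof -
  obtain \<beta> where G: "multigraph G" and \<beta>: "Z3_boundary G \<beta>" "flow_critical G \<beta>"
      and dense: "int (card (edges G)) > 3 * int (card (verts G)) - 5"
    using assms(1) unfolding dense_flow_critical_def by blast
  have "components G = {verts G}"
    by (rule connected_components) (use \<beta>(2) in \<open>simp add: flow_critical_def\<close>)
  then have zero: "(\<Sum>v\<in>verts G. \<beta> v) = 0" using \<beta>(1) unfolding Z3_boundary_def by simp
  interpret minimal_dense_graph G \<beta>
    by unfold_locales (use G \<beta>(2) zero dense assms(2) in auto)
  have "\<exists>v\<in>verts G. C = incident_edges G v" if "edge_cut G C" "card C = 5" for C
    using that cut_bound(2) unfolding edge_cut_def cut_def[symmetric] by blast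
  then show ?thesis using triangle_free_graph edge_connected_5 by blast
qed

end
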